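(* The matching policy First Come, First Matched ($\textsc{fcfm}$) is maximal: for any connected multigraph $G=(V,E)$ that is not a bipartite graph, $\mathrm{Stab}(G,\textsc{fcfm})=\mathrm{Ncond}(G)$. Moreover, for any $\mu\in\mathrm{Ncond}(G)$, the unique stationary probability $\Pi_W$ of the chain $(W_n)_{n\in\mathbb N}$ on $\mathbb W$ is given by $$\Pi_W(\varepsilon)=\alpha,\qquad \Pi_W(w)=\alpha\prod_{l=1}^{q}\frac{\mu(w_l)}{\mu\big(E(\{w_1,\dots,w_l\})\big)}\quad\text{for all } w=w_1\cdots w_q\in\mathbb W\setminus\{\varepsilon\},$$ where $\varepsilon$ is the empty word and $$\alpha^{-1}=1+\sum_{I\in\mathbb I(\check G)}\ \sum_{\sigma\in\mathfrak S_{|I|}}\ \prod_{i=1}^{|I|}\frac{\mu(e_{\sigma(i)})}{\mu\big(E(\{e_{\sigma(1)},\dots,e_{\sigma(i)}\})\big)-\mu\big(\{e_{\sigma(1)},\dots,e_{\sigma(i)}\}\cap V_2\big)},$$ with $I=\{e_1,\dots,e_{|I|}\}$ for each $I\in\mathbb I(\check G)$, and $\mathfrak S_n$ the symmetric group on $\{1,\dots,n\}$.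
   Context: A multigraph $G=(V,E)$ has a finite node set $V$ and a set $E$ of edges, each edge joining two distinct nodes or being a self-loop at a node; there are no parallel edges. Write $u - v$ if $u,v$ are joined by an edge ($u-u$ meaning a self-loop at $u$). $V_1=\{u: u-u\}$, $V_2=V\setminus V_1$. For $U\subset V$, $E(U)=\{v\in V:\exists u\in U,\ u-v\}$. The maximal subgraph $\check G$ is $G$ with all self-loops deleted. An independent set of $G$ is a nonempty set of nodes containing no edge of $G$ (in particular no node with a self-loop); $\mathbb I(G)$ is the set of independent sets of $G$, and likewise $\mathbb I(\check G)$ for $\check G$. A bipartite graph is a multigraph with no self-loop that is bipartite in the usual sense. $\mathscr M(V)$ is the set of probability measures on $V$ with full support, and $\mathrm{Ncond}(G)=\{\mu\in\mathscr M(V):\ \mu(I)<\mu(E(I))\ \ \forall I\in\mathbb I(G)\}$. Matching model $(G,\textsc{fcfm},\mu)$: at each time $n\ge1$ one item enters, with class $C_n\in V$, $(C_n)$ i.i.d. of law $\mu$. If the buffer contains an item whose class lies in $E(\{C_n\})$, the incoming item is matched with the oldest such item and both leave immediately; otherwise it is stored. $W_n$ is the word over $V$ listing the classes of unmatched items after the arrival at time $n$ in order of arrival. $(W_n)$ is a Markov chain on $\mathbb W$, the set of finite words $w$ over $V$ such that $|w|_i|w|_j=0$ for all distinct $i,j$ with $i-j$, and $|w|_i\le1$ for all $i\in V_1$ ($|w|_i$ is the number of occurrences of $i$ in $w$). The model is stable if $(W_n)$ is positive recurrent; $\mathrm{Stab}(G,\textsc{fcfm})$ is the set of $\mu\in\mathscr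 M(V)$ for which it is stable. *)

theory Defs
  imports "HOL-Probability.Probability" "HOL-Combinatorics.Permutations"
begin

text \<open>
  The edge joining \<open>u\<close> and \<open>v\<close> is the set \<open>{u, v}\<close>; a self-loop at \<open>u\<close> is the singleton \<open>{u}\<close>.
\<close>

definition multigraph :: "'a set \<Rightarrow> 'a set set \<Rightarrow> bool" where
  "multigraph V E \<longleftrightarrow> finite V \<and> (\<forall>e\<in>E. \<exists>u\<in>V. \<exists>v\<in>V. e = {u, v})"

definition adj :: "'a set set \<Rightarrow> 'a \<Rightarrow> 'a \<Rightarrow> bool" where
  "adj E u v \<longleftrightarrow> {u, v} \<in> E"

definition V1 :: "'a set \<Rightarrow> 'a set set \<Rightarrow> 'a set" where
  "V1 V E = {u \<in> V. adj E u u}"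

definition V2 :: "'a set \<Rightarrow> 'a set set \<Rightarrow> 'a set" where
  "V2 V E = V - V1 V E"

definition nbhd :: "'a set \<Rightarrow> 'a set set \<Rightarrow> 'a set \<Rightarrow> 'a set" where
  "nbhd V E U = {v \<in> V. \<exists>u\<in>U. adj E u v}"

text \<open>The maximal subgraph of \<open>(V, E)\<close> is \<open>(V, loopless E)\<close>.\<close>

definition loopless :: "'a set set \<Rightarrow> 'a set set" where
  "loopless E = {e \<in> E. \<forall>u. e \<noteq> {u}}"

definition independents :: "'a set \<Rightarrow> 'a set set \<Rightarrow> 'a set set" where
  "independents V E = {I. I \<noteq> {} \<and> I \<subseteq> V \<and> (\<forall>e\<in>E. \<not> e \<subseteq> I)}"

definition graph_connected :: "'a set \<Rightarrow> 'a set set \<Rightarrow> bool" where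
  "graph_connected V E \<longleftrightarrow> V \<noteq> {} \<and> (\<forall>u\<in>V. \<forall>v\<in>V. (adj E)\<^sup>*\<^sup>* u v)"

definition bipartite :: "'a set \<Rightarrow> 'a set set \<Rightarrow> bool" where
  "bipartite V E \<longleftrightarrow> V1 V E = {} \<and>
     (\<exists>A B. A \<union> B = V \<and> A \<inter> B = {} \<and> (\<forall>e\<in>E. \<exists>a\<in>A. \<exists>b\<in>B. e = {a, b}))"

definition full_support_measures :: "'a set \<Rightarrow> 'a pmf set" where
  "full_support_measures V = {\<mu>. set_pmf \<mu> = V}"

definition Ncond :: "'a set \<Rightarrow> 'a set set \<Rightarrow> 'a pmf set" where
  "Ncond V E = {\<mu> \<in> full_support_measures V.
     \<forall>I\<in>independents V E. measure_pmf.prob \<mu> I < measure_pmf.prob \<mu> (nbhd V E I)}"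

definition admissible_words :: "'a set \<Rightarrow> 'a set set \<Rightarrow> 'a list set" where
  "admissible_words V E = {w. set w \<subseteq> V \<and>
     (\<forall>i\<in>V. \<forall>j\<in>V. i \<noteq> j \<and> adj E i j \<longrightarrow> count_list w i * count_list w j = 0) \<and>
     (\<forall>i\<in>V1 V E. count_list w i \<le> 1)}"

text \<open>
  Words list the buffer from the oldest to the youngest item, so the oldest item compatible with
  an arrival of class \<open>c\<close> is the first letter of \<open>w\<close> lying in \<open>nbhd V E {c}\<close>.
\<close>

definition fcfm_step :: "'a set \<Rightarrow> 'a set set \<Rightarrow> 'a list \<Rightarrow> 'a \<Rightarrow> 'a list" where
  "fcfm_step V E w c =
     (if \<exists>x\<in>set w. x \<in> nbhd V E {c}
      then takeWhile (\<lambda>x. x \<notin> nbhd V E {c}) w @ tl (dropWhile (\<lambda>x. x \<notin> nbhd V E {c}) w)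
      else w @ [c])"

text \<open>
  Streams are indexed from 0: the class \<open>C\<^sub>n\<close> of the \<open>n\<close>-th arrival (\<open>n \<ge> 1\<close>) is \<open>C !! (n - 1)\<close>.
  Under \<open>stream_space (measure_pmf \<mu>)\<close> these classes are i.i.d. of law \<open>\<mu>\<close>.
\<close>

primrec fcfm_chain :: "'a set \<Rightarrow> 'a set set \<Rightarrow> 'a list \<Rightarrow> 'a stream \<Rightarrow> nat \<Rightarrow> 'a list" where
  "fcfm_chain V E w C 0 = w"
| "fcfm_chain V E w C (Suc n) = fcfm_step V E (fcfm_chain V E w C n) (C !! n)"

definition return_time :: "(nat \<Rightarrow> 's) \<Rightarrow> 's \<Rightarrow> enat" where
  "return_time X x = (INF n \<in> {n. n \<ge> 1 \<and> X n = x}. enat n)"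

definition expected_return_time :: "'a set \<Rightarrow> 'a set set \<Rightarrow> 'a pmf \<Rightarrow> 'a list \<Rightarrow> ennreal" where
  "expected_return_time V E \<mu> w =
     (\<integral>\<^sup>+ C. ennreal_of_enat (return_time (fcfm_chain V E w C) w) \<partial>stream_space (measure_pmf \<mu>))"

definition fcfm_positive_recurrent :: "'a set \<Rightarrow> 'a set set \<Rightarrow> 'a pmf \<Rightarrow> bool" where
  "fcfm_positive_recurrent V E \<mu> \<longleftrightarrow>
     (\<forall>w\<in>admissible_words V E. expected_return_time V E \<mu> w < \<infinity>)"

definition Stab_fcfm :: "'a set \<Rightarrow> 'a set set \<Rightarrow> 'a pmf set" where
  "Stab_fcfm V E = {\<mu> \<in> full_support_measures V. fcfm_positive_recurrent V E \<mu>}"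

definition fcfm_kernel :: "'a set \<Rightarrow> 'a set set \<Rightarrow> 'a pmf \<Rightarrow> 'a list \<Rightarrow> 'a list pmf" where
  "fcfm_kernel V E \<mu> w = map_pmf (fcfm_step V E w) \<mu>"

definition fcfm_stationary :: "'a set \<Rightarrow> 'a set set \<Rightarrow> 'a pmf \<Rightarrow> 'a list pmf \<Rightarrow> bool" where
  "fcfm_stationary V E \<mu> \<pi> \<longleftrightarrow>
     set_pmf \<pi> \<subseteq> admissible_words V E \<and> bind_pmf \<pi> (fcfm_kernel V E \<mu>) = \<pi>"

text \<open>
  \<open>e I 1, \<dots>, e I (card I)\<close> is an enumeration of each independent set \<open>I\<close> of the maximal subgraph.
  The neighbourhoods are taken in the full multigraph, self-loops included.
\<close>

definition enumerates_independents ::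
    "'a set \<Rightarrow> 'a set set \<Rightarrow> ('a set \<Rightarrow> nat \<Rightarrow> 'a) \<Rightarrow> bool" where
  "enumerates_independents V E e \<longleftrightarrow>
     (\<forall>I\<in>independents V (loopless E). bij_betw (e I) {1..card I} I)"

definition fcfm_alpha ::
    "'a set \<Rightarrow> 'a set set \<Rightarrow> 'a pmf \<Rightarrow> ('a set \<Rightarrow> nat \<Rightarrow> 'a) \<Rightarrow> real" where
  "fcfm_alpha V E \<mu> e = inverse (1 +
     (\<Sum>I\<in>independents V (loopless E). \<Sum>\<sigma> | \<sigma> permutes {1..card I}. \<Prod>i=1..card I.
        pmf \<mu> (e I (\<sigma> i)) /
        (measure_pmf.prob \<mu> (nbhd V E ((\<lambda>j. e I (\<sigma> j)) ` {1..i})) -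
         measure_pmf.prob \<mu> ((\<lambda>j. e I (\<sigma> j)) ` {1..i} \<inter> V2 V E))))"

end

theory Submission
  imports Defs "HOL-Combinatorics.Multiset_Permutations"
begin

text \<open>
  Write \<open>N(U)\<close> for the neighbourhood of a set \<open>U\<close> of classes. The buffer content
  \<open>w = w\<^sub>1\<dots>w\<^sub>q\<close> gets the weight \<open>\<Prod>\<^sub>l \<mu>(w\<^sub>l) / \<mu>(N{w\<^sub>1, \<dots>, w\<^sub>l})\<close>. These
  weights satisfy the balance equations by a telescoping sum. A state \<open>w\<close> is entered either by
  storing its last letter, or by matching an item \<open>x \<notin> N(w)\<close> that stood at some place \<open>k\<close> of the
  buffer, with an arrival that is compatible with \<open>x\<close> and with none of the first \<open>k\<close> letters of \<open>w\<close>.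
  The first way carries a flow \<open>\<mu>(N(w))\<close> times the weight of \<open>w\<close>. For a fixed \<open>x\<close>, the flows of
  the second kind telescope over \<open>k\<close> to \<open>\<mu>(x)\<close> times the weight of \<open>w\<close>
  (\<open>insertion_identity\<close>), and summing over \<open>x\<close> supplies the missing factor \<open>1 - \<mu>(N(w))\<close>.

  The total mass of the weights is found by recording, in a word, only the first occurrences of its
  letters. What lies between them repeats loopless letters seen before, so it contributes a geometric
  series of ratio \<open>\<mu>(U \<inter> V\<^sub>2) / \<mu>(N(U))\<close>, where \<open>U\<close> is the set of letters seen so far. The set
  \<open>U \<inter> V\<^sub>2\<close> is empty or independent, so the condition \<open>Ncond\<close> says precisely what makes these
  ratios less than one. The first occurrences form an ordering of an independent set of the maximal
  subgraph, whence the double sum in the constant \<open>\<alpha>\<close>.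

  Every state can be emptied, since the oldest item can always be matched next. Hence the stationary
  law is unique: the set of states where one stationary law exceeds another is closed under
  transitions (\<open>stationary_excess_closed\<close>), so it contains the empty word unless it is empty. Of two
  different laws each exceeds the other somewhere, and not both can do so at the empty word. Positive recurrence follows from a stationary law with full support by the
  inequality half of Kac's formula (\<open>kac_bound\<close>).

  Conversely, let \<open>I\<close> be independent with \<open>\<mu>(N(I)) \<le> \<mu>(I)\<close>. The number of buffered items in \<open>I\<close>
  minus the number in \<open>N(I)\<close> then does not decrease in the mean, while it is at most the length of
  the buffer, which grows at most linearly. A graph that is connected and not bipartite has an edge from
  \<open>N(I)\<close> to the outside of \<open>I\<close>; matching along it gives a strict gain. Together these force the
  probability that the empty word does not recur within \<open>n\<close> steps to be at least of order \<open>1/n\<close>, so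
  the mean return time diverges with the harmonic series.
\<close>

section \<open>Words grown letter by letter\<close>

text \<open>
  The admissible words, and the orderings of independent sets, are both obtained by adding letters
  one at a time, the letters allowed next and the factor gained depending only on the set of letters
  already present. Here \<open>A U\<close> is the set of letters that may follow when \<open>U\<close> is present, and
  \<open>a x W\<close> is the factor of a new letter \<open>x\<close>, with \<open>W\<close> the set of letters after it is added.
\<close>

primrec path_in :: "('a set \<Rightarrow> 'a set) \<Rightarrow> 'a set \<Rightarrow> 'a list \<Rightarrow> bool" where
  "path_in A U [] \<longleftrightarrow> True"
| "path_in A U (x # v) \<longleftrightarrow> x \<in> A U \<and> path_in A (insert x U) v"

primrec path_weight :: "('a \<Rightarrow> 'a set \<Rightarrow> real) \<Rightarrow> 'a set \<Rightarrow> 'a list \<Rightarrow> real" where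
  "path_weight a U [] = 1"
| "path_weight a U (x # v) = a x (insert x U) * path_weight a (insert x U) v"

definition path_sum :: "('a set \<Rightarrow> 'a set) \<Rightarrow> ('a \<Rightarrow> 'a set \<Rightarrow> real) \<Rightarrow> nat \<Rightarrow> 'a set \<Rightarrow> real" where
  "path_sum A a n U = (\<Sum>v | path_in A U v \<and> length v \<le> n. path_weight a U v)"

lemma path_in_snoc: "path_in A U (v @ [x]) \<longleftrightarrow> path_in A U v \<and> x \<in> A (U \<union> set v)"
  by (induction v arbitrary: U) auto

lemma path_weight_snoc:
  "path_weight a U (v @ [x]) = path_weight a U v * a x (insert x (U \<union> set v))"
  by (induction v arbitrary: U) (auto simp: insert_commute)

lemma path_weight_eq_prod:
  "path_weight a U v = (\<Prod>l=1..length v. a (v ! (l - 1)) (U \<union> set (take l v)))"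
proof (induction v rule: rev_induct)
  case (snoc x v)
  have "(\<Prod>l=1..length v. a ((v @ [x]) ! (l - 1)) (U \<union> set (take l (v @ [x])))) =
        (\<Prod>l=1..length v. a (v ! (l - 1)) (U \<union> set (take l v)))"
    by (intro prod.cong) (auto simp: nth_append)
  then show ?case
    by (simp add: path_weight_snoc snoc)
qed simp

lemma path_in_subset: "(\<And>U. A U \<subseteq> V) \<Longrightarrow> path_in A U v \<Longrightarrow> set v \<subseteq> V"
  by (induction v arbitrary: U) auto

lemma finite_paths:
  assumes "finite V" and "\<And>U. A U \<subseteq> V"
  shows "finite {v. path_in A U v \<and> length v \<le> n}"
proof (rule finite_subset[OF _ finite_lists_length_le[OF assms(1), of n]])
  show "{v. path_in A U v \<and> length v \<le> n} \<subseteq> {xs. set xs \<subseteq> V \<and> length xs \<le> n}"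
    using path_in_subset[of A V] assms(2) by blast
qed

lemma path_sum_0 [simp]: "path_sum A a 0 U = 1"
proof -
  have "{v. path_in A U v \<and> length v \<le> 0} = {[]}" by auto
  then show ?thesis by (simp add: path_sum_def)
qed

lemma path_sum_Suc:
  assumes "finite V" and "\<And>U. A U \<subseteq> V"
  shows "path_sum A a (Suc n) U =
    1 + (\<Sum>x\<in>A U. a x (insert x U) * path_sum A a n (insert x U))"
proof -
  have fin: "finite {v. path_in A W v \<and> length v \<le> m}" for W m
    using finite_paths[OF assms] .
  have finA: "finite (A U)" using assms finite_subset by blast
  let ?T = "\<lambda>x. (#) x ` {v. path_in A (insert x U) v \<and> length v \<le> n}"
  have split: "{v. path_in A U v \<and> length v \<le> Suc n} = insert [] (\<Union>x\<in>A U. ?T x)"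
  proof (intro set_eqI iffI)
    fix v assume "v \<in> {v. path_in A U v \<and> length v \<le> Suc n}"
    then show "v \<in> insert [] (\<Union>x\<in>A U. ?T x)" by (cases v) auto
  qed auto
  have "path_sum A a (Suc n) U = 1 + (\<Sum>v\<in>(\<Union>x\<in>A U. ?T x). path_weight a U v)"
    unfolding path_sum_def split using finA fin by (subst sum.insert) auto
  also have "(\<Sum>v\<in>(\<Union>x\<in>A U. ?T x). path_weight a U v) = (\<Sum>x\<in>A U. \<Sum>v\<in>?T x. path_weight a U v)"
    using finA fin by (intro sum.UNION_disjoint) auto
  also have "\<dots> = (\<Sum>x\<in>A U. a x (insert x U) * path_sum A a n (insert x U))"
    by (intro sum.cong refl) (subst sum.reindex, auto simp: path_sum_def sum_distrib_left)
  finally show ?thesis .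
qed

text \<open>
  Monotonicity makes boundedness suffice: the limit is then the fixed point of the limiting
  recursion. The truncated sums of a geometric series with converging source terms have this form.
\<close>

lemma affine_recursion_tendsto:
  fixes x b :: "nat \<Rightarrow> real"
  assumes rec: "\<And>n. x (Suc n) = r * x n + b n" and b: "b \<longlonglongrightarrow> c" and r: "0 \<le> r" "r < 1"
    and mono: "incseq x"
  shows "x \<longlonglongrightarrow> c / (1 - r)"
proof -
  from b have "Bseq b" by (intro convergent_imp_Bseq) (auto simp: convergent_def)
  then obtain B where B: "\<And>n. b n \<le> B"
    by (auto simp: Bseq_def real_norm_def) (metis abs_le_D1)
  have "x n \<le> B / (1 - r)" for n
  proof -
    have "x n \<le> x (Suc n)" using mono by (simp add: incseq_SucD)
    also have "\<dots> \<le> r * x n + B" using rec B by simp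
    finally show ?thesis using r by (simp add: field_simps)
  qed
  then obtain L where L: "x \<longlonglongrightarrow> L"
    using incseq_convergent[OF mono] by metis
  have "(\<lambda>n. x (Suc n)) \<longlonglongrightarrow> r * L + c"
    unfolding rec using L b by (intro tendsto_intros)
  moreover have "(\<lambda>n. x (Suc n)) \<longlonglongrightarrow> L" using L by (rule LIMSEQ_Suc)
  ultimately have "L = r * L + c" using LIMSEQ_unique by blast
  then have "L = c / (1 - r)" using r by (simp add: field_simps)
  with L show ?thesis by simp
qed

section \<open>The matching model and its words\<close>

text \<open>
  Connectedness and non-bipartiteness enter most of the argument only through the consequence that no
  class is isolated, so that all neighbourhoods of nonempty sets have positive mass.
\<close>

locale matching_model =
  fixes V :: "'a set" and E :: "'a set set" and \<mu> :: "'a pmf"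
  assumes multigraph: "multigraph V E" and support: "set_pmf \<mu> = V"
    and neighbour: "\<And>u. u \<in> V \<Longrightarrow> \<exists>v\<in>V. adj E u v"
begin

abbreviation "N \<equiv> nbhd V E"
abbreviation "mass U \<equiv> measure_pmf.prob \<mu> U"

lemma finite_V: "finite V"
  using multigraph by (simp add: multigraph_def)

lemma adj_sym: "adj E u v \<longleftrightarrow> adj E v u"
  by (simp add: adj_def insert_commute)

lemma adj_V: "adj E u v \<Longrightarrow> u \<in> V \<and> v \<in> V"
  using multigraph by (fastforce simp: adj_def multigraph_def doubleton_eq_iff)

lemma N_subset: "N U \<subseteq> V" by (auto simp: nbhd_def)

lemma N_empty [simp]: "N {} = {}" by (simp add: nbhd_def)

lemma N_insert: "N (insert x U) = N {x} \<union> N U" by (auto simp: nbhd_def)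

lemma N_mono: "U \<subseteq> W \<Longrightarrow> N U \<subseteq> N W" by (auto simp: nbhd_def)

lemma mem_N_singleton: "x \<in> N {c} \<longleftrightarrow> adj E c x"
  using adj_V by (auto simp: nbhd_def)

lemma mem_N: "x \<in> N U \<longleftrightarrow> (\<exists>u\<in>U. adj E u x)"
  using adj_V by (auto simp: nbhd_def)

lemma mass_pos: "U \<subseteq> V \<Longrightarrow> U \<noteq> {} \<Longrightarrow> mass U > 0"
  using support measure_pmf_posI[of _ \<mu> U] by blast

lemma mass_N_pos: "x \<in> V \<Longrightarrow> x \<in> U \<Longrightarrow> mass (N U) > 0"
  using neighbour[of x] mass_pos[OF N_subset, of U] mem_N by blast

lemma admissible_snoc:
  "w @ [x] \<in> admissible_words V E \<longleftrightarrow> w \<in> admissible_words V E \<and> x \<in> V - N (set w)"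
proof
  assume a: "w @ [x] \<in> admissible_words V E"
  have x: "x \<in> V" using a by (auto simp: admissible_words_def)
  have "\<not> adj E u x" if "u \<in> set w" for u
  proof (cases "u = x")
    case True
    have "count_list w x \<noteq> 0" using that True by (simp add: count_list_0_iff)
    then show ?thesis using a x True by (fastforce simp: admissible_words_def V1_def)
  next
    case False
    have "u \<in> V" using a that by (auto simp: admissible_words_def)
    moreover have "count_list w u \<noteq> 0" using that by (simp add: count_list_0_iff)
    ultimately show ?thesis using a x False by (fastforce simp: admissible_words_def)
  qed
  then have "x \<notin> N (set w)" by (auto simp: mem_N)
  moreover have "w \<in> admissible_words V E" using a
    by (fastforce simp: admissible_words_def split: if_splits)
  ultimately show "w \<in> admissible_words V E \<and> x \<in> V - N (set w)" using x by simp
next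
  assume a: "w \<in> admissible_words V E \<and> x \<in> V - N (set w)"
  have "count_list w u = 0" if "adj E u x" for u
    using a that by (auto simp: count_list_0_iff mem_N)
  with a show "w @ [x] \<in> admissible_words V E"
    using adj_sym by (auto simp: admissible_words_def V1_def)
qed

abbreviation "storable U \<equiv> V - N U"

lemma admissible_iff_path: "w \<in> admissible_words V E \<longleftrightarrow> path_in storable {} w"
  by (induction w rule: rev_induct)
     (auto simp: admissible_snoc path_in_snoc, auto simp: admissible_words_def)

text \<open>
  Adjacency is symmetric, so a letter may be inserted anywhere in an admissible word under the same
  condition as at its end. This is what makes the set of letters \<open>x\<close> in the balance equations
  independent of the place of insertion.
\<close>

lemma path_in_storable_insert:
  "path_in storable U (u @ x # v) \<longleftrightarrow>
     path_in storable U (u @ v) \<and> x \<in> V - N (U \<union> set u \<union> set v)"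
proof (induction u arbitrary: U)
  case Nil
  show ?case
  proof (induction v arbitrary: U)
    case (Cons y v)
    show ?case using Cons[of "insert y U"]
      by (auto simp: insert_commute mem_N adj_sym)
  qed simp
next
  case (Cons y u)
  then show ?case by (auto simp: insert_commute)
qed

lemma admissible_insert:
  "u @ x # v \<in> admissible_words V E \<longleftrightarrow> u @ v \<in> admissible_words V E \<and> x \<in> V - N (set (u @ v))"
  by (simp add: admissible_iff_path path_in_storable_insert)

lemma Nil_admissible: "[] \<in> admissible_words V E"
  by (simp add: admissible_iff_path)

lemma fcfm_step_stored: "(\<And>x. x \<in> set w \<Longrightarrow> \<not> adj E c x) \<Longrightarrow> fcfm_step V E w c = w @ [c]"
  by (auto simp: fcfm_step_def mem_N_singleton)

lemma fcfm_step_matched: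
  "(\<And>y. y \<in> set u \<Longrightarrow> \<not> adj E c y) \<Longrightarrow> adj E c x \<Longrightarrow> fcfm_step V E (u @ x # v) c = u @ v"
  by (auto simp: fcfm_step_def mem_N_singleton)

lemma fcfm_step_cases:
  obtains (stored) "\<And>x. x \<in> set w \<Longrightarrow> \<not> adj E c x" "fcfm_step V E w c = w @ [c]"
  | (matched) u x v where "w = u @ x # v" "\<And>y. y \<in> set u \<Longrightarrow> \<not> adj E c y" "adj E c x"
      "fcfm_step V E w c = u @ v"
proof (cases "\<exists>x\<in>set w. adj E c x")
  case True
  then obtain u x v where "w = u @ x # v" "adj E c x" "\<forall>y\<in>set u. \<not> adj E c y"
    using split_list_first_prop[of w "adj E c"] by blast
  then show ?thesis using matched fcfm_step_matched by metis
next
  case False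
  then show ?thesis using stored fcfm_step_stored by metis
qed

section \<open>Balance equations\<close>

abbreviation "letter_weight x U \<equiv> pmf \<mu> x / mass (N U)"
abbreviation "weight \<equiv> path_weight letter_weight"

lemma weight_pos: "set w \<subseteq> V \<Longrightarrow> weight U w > 0"
proof (induction w arbitrary: U)
  case (Cons x w)
  have "pmf \<mu> x > 0" using Cons.prems support by (auto simp: pmf_positive)
  moreover have "mass (N (insert x U)) > 0" using Cons.prems by (intro mass_N_pos[of x]) auto
  ultimately show ?case using Cons by simp
qed simp

text \<open>
  Exchanging the first two letters affects only the neighbourhood of the first one, as the later
  factors depend on the set of preceding letters and not on their order.
\<close>

lemma weight_swap:
  "weight U (x # a # v) * mass (N (insert x U)) =
     letter_weight a (insert a U) * mass (N (insert a U)) * weight (insert a U) (x # v)"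
  if "x \<in> V" "a \<in> V"
  using mass_N_pos[of x "insert x U"] mass_N_pos[of a "insert a U"] that
  by (simp add: insert_commute)

text \<open>
  Let \<open>D\<^sub>k\<close> and \<open>D'\<^sub>k\<close> be the masses of the neighbourhoods of \<open>U\<close> with the first \<open>k\<close> letters of \<open>v\<close>,
  without and with \<open>x\<close>. The term of index \<open>k\<close> is a constant times
  \<open>(D'\<^sub>k - D\<^sub>k) / (D\<^sub>1 \<dots> D\<^sub>k D'\<^sub>k \<dots> D'\<^sub>q)\<close>, which is the difference \<open>T\<^sub>k - T\<^sub>k\<^sub>-\<^sub>1\<close> for
  \<open>T\<^sub>k = 1 / (D\<^sub>1 \<dots> D\<^sub>k D'\<^sub>k\<^sub>+\<^sub>1 \<dots> D'\<^sub>q)\<close>. The boundary term on the right, which comes from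
  \<open>k = 0\<close>, vanishes when \<open>U = {}\<close>; a general \<open>U\<close> is what the induction needs.
\<close>

lemma insertion_identity:
  assumes "x \<in> V" and "set v \<subseteq> V"
  shows "(\<Sum>k\<le>length v. weight U (take k v @ x # drop k v) *
           (mass (N (insert x (U \<union> set (take k v)))) - mass (N (U \<union> set (take k v))))) =
         pmf \<mu> x * weight U v - mass (N U) * weight U (x # v)"
  using assms(2)
proof (induction v arbitrary: U)
  case Nil
  then show ?case using mass_N_pos[of x "insert x U"] assms(1) by (simp add: field_simps)
next
  case (Cons a v)
  let ?q = "letter_weight a (insert a U)"
  let ?f = "\<lambda>U v k. weight U (take k v @ x # drop k v) *
           (mass (N (insert x (U \<union> set (take k v)))) - mass (N (U \<union> set (take k v))))"
  have "(\<Sum>k\<le>length (a # v). ?f U (a # v) k) =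
        ?f U (a # v) 0 + (\<Sum>k\<le>length v. ?f U (a # v) (Suc k))"
    by (simp only: list.size add_0_right add_Suc_right sum.atMost_Suc_shift)
  also have "(\<Sum>k\<le>length v. ?f U (a # v) (Suc k)) = ?q * (\<Sum>k\<le>length v. ?f (insert a U) v k)"
    by (simp add: sum_distrib_left insert_commute mult.assoc)
  also have "\<dots> = ?q * (pmf \<mu> x * weight (insert a U) v
      - mass (N (insert a U)) * weight (insert a U) (x # v))"
    using Cons by (simp only: set_simps insert_subset Un_insert_right simp_thms)
  also have "?f U (a # v) 0 = weight U (x # a # v) * mass (N (insert x U)) - mass (N U) * weight U (x # a # v)"
    by (simp del: path_weight.simps add: algebra_simps)
  also have "weight U (x # a # v) * mass (N (insert x U)) =
      ?q * mass (N (insert a U)) * weight (insert a U) (x # v)"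
    using Cons.prems assms(1) by (intro weight_swap) auto
  finally show ?case
    unfolding path_weight.simps(2)[of _ U a v] by (simp only: algebra_simps)
qed

definition invariant_weight :: "'a list \<Rightarrow> real" where
  "invariant_weight w = (if w \<in> admissible_words V E then weight {} w else 0)"

lemma admissible_subset: "w \<in> admissible_words V E \<Longrightarrow> set w \<subseteq> V"
  by (simp add: admissible_words_def)

lemma invariant_weight_pos: "w \<in> admissible_words V E \<Longrightarrow> invariant_weight w > 0"
  by (simp add: invariant_weight_def weight_pos admissible_subset)

lemma invariant_weight_nonneg: "invariant_weight w \<ge> 0"
  using invariant_weight_pos[of w] by (cases "w \<in> admissible_words V E") (auto simp: invariant_weight_def)

lemma mass_new_neighbours:
  "mass (N {x} - N U) = mass (N (insert x U)) - mass (N U)"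
proof -
  have "N {x} - N U = N (insert x U) - N U" by (auto simp: N_insert[of x U])
  then show ?thesis
    by (simp add: measure_pmf.finite_measure_Diff N_mono subset_insertI)
qed

text \<open>
  A finite set containing all pairs of a state and an arrival that lead to \<open>w\<close>. The triple
  \<open>(k, x, c)\<close> stands for an item \<open>x\<close> at place \<open>k\<close> which is removed by an arrival \<open>c\<close>.
\<close>

definition predecessors :: "'a list \<Rightarrow> ('a list \<times> 'a) set" where
  "predecessors w =
    (if w = [] then {} else {(butlast w, last w)}) \<union>
    (\<lambda>(k, x, c). (take k w @ x # drop k w, c)) `
      (SIGMA k:{..length w}. SIGMA x:storable (set w). N {x} - N (set (take k w)))"

lemma step_in_predecessors:
  assumes "w' \<in> admissible_words V E" and "fcfm_step V E w' c = w" and "c \<in> V"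
  shows "(w', c) \<in> predecessors w"
proof (cases rule: fcfm_step_cases[of w' c])
  case stored
  then show ?thesis using assms by (auto simp: predecessors_def)
next
  case (matched u x v)
  have w: "w = u @ v" using matched assms by simp
  have "x \<in> storable (set w)" using assms(1) unfolding matched w admissible_insert by simp
  moreover have "c \<in> N {x} - N (set u)"
    using matched(2,3) adj_sym by (auto simp: mem_N)
  ultimately have "(length u, x, c) \<in>
      (SIGMA k:{..length w}. SIGMA x:storable (set w). N {x} - N (set (take k w)))"
    by (simp add: w)
  then show ?thesis
    unfolding predecessors_def by (intro UnI2 image_eqI[of _ _ "(length u, x, c)"]) (auto simp: w matched)
qed

text \<open>
  Only an upper bound is claimed, so it does not matter whether different triples give different
  transitions into \<open>w\<close>. Equality comes for free afterwards, as two probability laws with comparable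
  masses at all points are equal.
\<close>

lemma inflow_le:
  assumes w: "w \<in> admissible_words V E"
  shows "finite (predecessors w)"
    and "(\<Sum>(w', c)\<in>predecessors w. invariant_weight w' * pmf \<mu> c) \<le> invariant_weight w"
proof -
  let ?h = "\<lambda>(w', c). invariant_weight w' * pmf \<mu> c"
  let ?f = "\<lambda>(k, x, c). (take k w @ x # drop k w, c)"
  let ?A = "if w = [] then {} else {(butlast w, last w)}"
  let ?I = "SIGMA k:{..length w}. SIGMA x:storable (set w). N {x} - N (set (take k w))"
  have finN: "finite (N U)" for U using N_subset finite_V finite_subset by blast
  have finI: "finite ?I" using finite_V finN by (intro finite_SigmaI) auto
  then show fin: "finite (predecessors w)" by (auto simp: predecessors_def)
  have h0: "?h z \<ge> 0" for z by (cases z) (simp add: invariant_weight_nonneg)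
  have stored: "sum ?h ?A = weight {} w * mass (N (set w))"
  proof (cases w rule: rev_cases)
    case (snoc u c)
    have u: "u \<in> admissible_words V E" "c \<in> V" using w by (auto simp: snoc admissible_snoc)
    have "mass (N (insert c (set u))) > 0" using u by (intro mass_N_pos) auto
    then show ?thesis using u by (simp add: snoc invariant_weight_def path_weight_snoc)
  qed simp
  have ins: "invariant_weight (take k w @ x # drop k w) = weight {} (take k w @ x # drop k w)"
    if "x \<in> storable (set w)" for k x
    using that w by (simp add: invariant_weight_def admissible_insert)
  have "sum ?h (?f ` ?I) \<le> sum (?h \<circ> ?f) ?I"
    using finI h0 by (intro sum_image_le) auto
  also have "\<dots> = (\<Sum>k\<le>length w. \<Sum>x\<in>storable (set w). \<Sum>c\<in>N {x} - N (set (take k w)).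
      invariant_weight (take k w @ x # drop k w) * pmf \<mu> c)"
    using finite_V finN by (simp add: sum.Sigma split_def)
  also have "\<dots> = (\<Sum>k\<le>length w. \<Sum>x\<in>storable (set w).
      weight {} (take k w @ x # drop k w) *
        (mass (N (insert x (set (take k w)))) - mass (N (set (take k w)))))"
  proof (intro sum.cong refl)
    fix k x assume "x \<in> storable (set w)"
    moreover have "(\<Sum>c\<in>N {x} - N (set (take k w)). pmf \<mu> c) = mass (N {x} - N (set (take k w)))"
      using finN by (simp add: measure_measure_pmf_finite)
    ultimately show "(\<Sum>c\<in>N {x} - N (set (take k w)). invariant_weight (take k w @ x # drop k w) * pmf \<mu> c) =
        weight {} (take k w @ x # drop k w) * (mass (N (insert x (set (take k w)))) - mass (N (set (take k w))))"
      by (simp only: ins mass_new_neighbours flip: sum_distrib_left)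
  qed
  \<comment> \<open>Exchanging the sums leaves, for each \<open>x\<close>, the telescoping sum over the places of insertion.\<close>
  also have "\<dots> = (\<Sum>x\<in>storable (set w). pmf \<mu> x * weight {} w)"
    using insertion_identity[of _ w "{}"] admissible_subset[OF w]
    by (subst sum.swap) (auto intro!: sum.cong)
  also have "\<dots> = weight {} w * mass (storable (set w))"
    using finite_V by (simp add: measure_measure_pmf_finite mult.commute[of "weight {} w"] sum_distrib_right)
  also have "mass (storable (set w)) = 1 - mass (N (set w))"
  proof -
    have "mass V = 1" using support by (simp add: measure_pmf.prob_eq_1 AE_measure_pmf_iff)
    then show ?thesis using N_subset by (simp add: measure_pmf.finite_measure_Diff)
  qed
  finally have "sum ?h (?f ` ?I) \<le> weight {} w * (1 - mass (N (set w)))" .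
  moreover have "sum ?h (predecessors w) \<le> sum ?h ?A + sum ?h (?f ` ?I)"
  proof -
    have "sum ?h (?A \<union> ?f ` ?I) + sum ?h (?A \<inter> ?f ` ?I) = sum ?h ?A + sum ?h (?f ` ?I)"
      using finI by (intro sum.union_inter) auto
    moreover have "sum ?h (?A \<inter> ?f ` ?I) \<ge> 0" using h0 by (intro sum_nonneg) auto
    ultimately show ?thesis unfolding predecessors_def by linarith
  qed
  moreover have "invariant_weight w = weight {} w" using w by (simp add: invariant_weight_def)
  ultimately show "sum ?h (predecessors w) \<le> invariant_weight w"
    unfolding stored right_diff_distrib by linarith
qed

lemma admissible_step:
  assumes "w \<in> admissible_words V E" "c \<in> V"
  shows "fcfm_step V E w c \<in> admissible_words V E"
proof (cases rule: fcfm_step_cases[of w c])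
  case stored
  then show ?thesis using assms adj_sym by (auto simp: admissible_snoc mem_N)
next
  case (matched u x v)
  then show ?thesis using assms by (simp add: admissible_insert)
qed

lemma fcfm_stationaryI:
  assumes \<pi>: "\<And>w. pmf \<pi> w = invariant_weight w / Z" and Z: "Z > 0"
  shows "fcfm_stationary V E \<mu> \<pi>"
proof -
  have supp: "set_pmf \<pi> \<subseteq> admissible_words V E"
    using \<pi> by (auto simp: set_pmf_eq invariant_weight_def)
  have eq: "bind_pmf \<pi> (fcfm_kernel V E \<mu>) =
      map_pmf (\<lambda>(w', c). fcfm_step V E w' c) (pair_pmf \<pi> \<mu>)" (is "_ = map_pmf ?s _")
    by (simp add: fcfm_kernel_def[abs_def] pair_pmf_def map_pmf_def bind_assoc_pmf bind_return_pmf)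
  have le: "pmf (bind_pmf \<pi> (fcfm_kernel V E \<mu>)) w \<le> pmf \<pi> w" for w
  proof (cases "w \<in> admissible_words V E")
    case True
    note fin = inflow_le(1)[OF True]
    have "pmf (bind_pmf \<pi> (fcfm_kernel V E \<mu>)) w =
        measure (pair_pmf \<pi> \<mu>) (?s -` {w} \<inter> set_pmf (pair_pmf \<pi> \<mu>))"
      by (simp only: eq pmf_map measure_Int_set_pmf)
    also have "\<dots> \<le> measure (pair_pmf \<pi> \<mu>) (predecessors w)"
    proof (rule measure_pmf.finite_measure_mono)
      show "?s -` {w} \<inter> set_pmf (pair_pmf \<pi> \<mu>) \<subseteq> predecessors w"
        using step_in_predecessors[of _ _ w] supp support by auto
    qed simp
    also have "\<dots> = (\<Sum>(w', c)\<in>predecessors w. invariant_weight w' * pmf \<mu> c) / Z"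
      unfolding measure_measure_pmf_finite[OF fin] sum_divide_distrib
      by (intro sum.cong refl) (auto simp: pmf_pair \<pi>)
    also have "\<dots> \<le> pmf \<pi> w"
      using inflow_le(2)[OF True] Z by (simp add: \<pi> divide_right_mono)
    finally show ?thesis .
  next
    case False
    then have "w \<notin> set_pmf (bind_pmf \<pi> (fcfm_kernel V E \<mu>))"
      using supp admissible_step support by (auto simp: fcfm_kernel_def)
    then have "pmf (bind_pmf \<pi> (fcfm_kernel V E \<mu>)) w = 0"
      by (simp add: pmf_eq_0_set_pmf del: set_bind_pmf)
    then show ?thesis by simp
  qed
  have "bind_pmf \<pi> (fcfm_kernel V E \<mu>) = \<pi>"
    using pmf_neq_exists_less[of \<pi> "bind_pmf \<pi> (fcfm_kernel V E \<mu>)"] le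
    by (metis not_le)
  then show ?thesis using supp by (simp add: fcfm_stationary_def)
qed

section \<open>Uniqueness of the stationary law\<close>

text \<open>
  An arrival adjacent to the oldest item is matched with it. Hence the buffer can always be emptied
  from the front.
\<close>

lemma tl_in_kernel:
  assumes "w \<in> admissible_words V E" and "w \<noteq> []"
  shows "tl w \<in> set_pmf (fcfm_kernel V E \<mu> w)"
proof -
  obtain x v where w: "w = x # v" using assms(2) by (cases w) auto
  have "x \<in> V" using admissible_subset[OF assms(1)] by (simp add: w)
  then obtain c where "c \<in> V" "adj E c x" using neighbour adj_sym by blast
  then show ?thesis using fcfm_step_matched[of "[]" c x v] support
    by (auto simp: fcfm_kernel_def w intro!: image_eqI[of _ _ c])
qed

lemma Nil_in_closed_set:
  assumes "w \<in> A" and "A \<subseteq> admissible_words V E"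
    and "\<And>w. w \<in> A \<Longrightarrow> set_pmf (fcfm_kernel V E \<mu> w) \<subseteq> A"
  shows "[] \<in> A"
  using assms(1)
proof (induction w)
  case (Cons x v)
  then have "v \<in> set_pmf (fcfm_kernel V E \<mu> (x # v))"
    using tl_in_kernel[of "x # v"] assms(2) by auto
  then show ?case using Cons assms(3) by blast
qed

end

text \<open>
  Let \<open>A\<close> be the set where \<open>p\<close> exceeds \<open>q\<close>, and \<open>\<phi> x = 1\<^sub>A x - K x A\<close>. Stationarity gives \<open>\<phi>\<close>
  mean zero under both laws. As \<open>\<phi>\<close> is nonnegative on \<open>A\<close> and nonpositive off it, it has
  everywhere the sign of \<open>p - q\<close>, so that all terms of \<open>\<Sum>\<^sub>x (p x - q x) \<phi> x = 0\<close> vanish. On \<open>A\<close> this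
  means \<open>K x A = 1\<close>.
\<close>

lemma stationary_excess_closed:
  assumes p: "bind_pmf p K = p" and q: "bind_pmf q K = q" and x: "pmf q x < pmf p x"
  shows "set_pmf (K x) \<subseteq> {x. pmf q x < pmf p x}"
proof -
  let ?A = "{x. pmf q x < pmf p x}"
  let ?k = "\<lambda>x. measure_pmf.prob (K x) ?A"
  define \<phi> where "\<phi> x = indicator ?A x - ?k x" for x
  have b: "\<bar>\<phi> x\<bar> \<le> 1" for x
    using measure_pmf.prob_le_1[of "K x" ?A] measure_nonneg[of "K x" ?A]
    unfolding \<phi>_def indicator_def abs_le_iff by (cases "x \<in> ?A"; simp; linarith)
  have int: "integrable (count_space UNIV) (\<lambda>x. pmf r x * \<phi> x)" for r
    by (rule Bochner_Integration.integrable_bound[OF integrable_pmf[of UNIV r]])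
       (use b in \<open>auto simp: abs_mult intro!: AE_I2 mult_left_le\<close>)
  have zero: "(\<integral>x. pmf r x * \<phi> x \<partial>count_space UNIV) = 0" if r: "bind_pmf r K = r" for r
  proof -
    have i1: "integrable r (indicator ?A :: _ \<Rightarrow> real)" by (simp add: integrable_indicator_iff measure_pmf.emeasure_eq_measure)
    have i2: "integrable r ?k"
      by (intro measure_pmf.integrable_const_bound[where B=1]) auto
    have "measure r ?A = (\<integral>x. ?k x \<partial>r)"
    proof -
      have "ennreal (measure r ?A) = (\<integral>\<^sup>+x. ennreal (?k x) \<partial>r)"
        using emeasure_bind_pmf[of r K ?A] unfolding r by (simp add: measure_pmf.emeasure_eq_measure)
      also have "\<dots> = ennreal (\<integral>x. ?k x \<partial>r)"
        by (rule nn_integral_eq_integral[OF i2]) simp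
      finally show ?thesis by (simp add: integral_nonneg)
    qed
    then have "(\<integral>x. \<phi> x \<partial>r) = 0"
      unfolding \<phi>_def using i1 i2 by (subst Bochner_Integration.integral_diff) auto
    then show ?thesis
      unfolding measure_pmf_eq_density by (subst (asm) integral_density) auto
  qed
  have "(\<integral>x. pmf p x * \<phi> x - pmf q x * \<phi> x \<partial>count_space UNIV) = 0"
    using int by (subst Bochner_Integration.integral_diff) (auto simp: zero p q)
  moreover have nonneg: "pmf p x * \<phi> x - pmf q x * \<phi> x \<ge> 0" for x
  proof (cases "x \<in> ?A")
    case True
    then have "\<phi> x \<ge> 0" by (simp add: \<phi>_def)
    then have "pmf q x * \<phi> x \<le> pmf p x * \<phi> x" using True by (intro mult_right_mono) auto
    then show ?thesis by simp
  next
    case False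
    then have "\<phi> x \<le> 0" by (simp add: \<phi>_def)
    then have "pmf q x * \<phi> x \<le> pmf p x * \<phi> x" using False by (intro mult_right_mono_neg) auto
    then show ?thesis by simp
  qed
  ultimately have "AE x in count_space UNIV. pmf p x * \<phi> x - pmf q x * \<phi> x = 0"
    using int by (subst (asm) integral_nonneg_eq_0_iff_AE) auto
  then have "(pmf p x - pmf q x) * \<phi> x = 0"
    by (simp add: AE_count_space algebra_simps)
  then have "?k x = 1" using x by (simp add: \<phi>_def)
  then show ?thesis
    by (auto simp: measure_pmf.prob_eq_1 AE_measure_pmf_iff)
qed

context matching_model
begin

lemma fcfm_stationary_unique:
  assumes p: "fcfm_stationary V E \<mu> p" and q: "fcfm_stationary V E \<mu> q"
  shows "p = q"
proof (rule ccontr)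
  assume ne: "p \<noteq> q"
  have Nil: "pmf s [] < pmf r []"
    if r: "fcfm_stationary V E \<mu> r" and s: "fcfm_stationary V E \<mu> s" and "r \<noteq> s" for r s
  proof -
    have "s \<noteq> r" using \<open>r \<noteq> s\<close> by simp
    then obtain w where w: "w \<in> {w. pmf s w < pmf r w}" using pmf_neq_exists_less by blast
    have "{w. pmf s w < pmf r w} \<subseteq> set_pmf r"
      using pmf_nonneg[of s] by (fastforce simp: set_pmf_iff not_le[symmetric])
    then show ?thesis
      using Nil_in_closed_set[OF w] stationary_excess_closed[of r _ s] r s
      unfolding fcfm_stationary_def by blast
  qed
  show False using Nil[OF p q ne] Nil[OF q p] ne by simp
qed

section \<open>The normalising constant\<close>

abbreviation "fresh U \<equiv> V - U - N U"
abbreviation "lingering U \<equiv> mass (U \<inter> V2 V E)"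
abbreviation "fresh_weight x U \<equiv> pmf \<mu> x / (mass (N U) - lingering U)"

text \<open>
  Independence in the maximal subgraph, with the empty set admitted: letter sets of admissible words.
\<close>

definition loopless_independent :: "'a set \<Rightarrow> bool" where
  "loopless_independent U \<longleftrightarrow> U \<subseteq> V \<and> (\<forall>u\<in>U. \<forall>v\<in>U. u \<noteq> v \<longrightarrow> \<not> adj E u v)"

lemma loopless_independent_insert:
  "loopless_independent U \<Longrightarrow> x \<in> fresh U \<Longrightarrow> loopless_independent (insert x U)"
  using adj_sym by (auto simp: loopless_independent_def mem_N)

text \<open>
  A letter already present may be stored again exactly if it has no self-loop. This separates the
  repetitions, which leave \<open>U\<close> unchanged, from the letters that enlarge \<open>U\<close>.
\<close>

lemma storable_split:
  assumes "loopless_independent U"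
  shows "storable U = (U \<inter> V2 V E) \<union> fresh U"
proof -
  have "x \<in> N U \<longleftrightarrow> adj E x x" if x: "x \<in> U" for x
  proof
    assume "x \<in> N U"
    then obtain u where u: "u \<in> U" "adj E u x" using mem_N by blast
    then have "u = x" using assms x unfolding loopless_independent_def by metis
    then show "adj E x x" using u by simp
  next
    assume "adj E x x"
    then show "x \<in> N U" using x mem_N by blast
  qed
  moreover have "U \<subseteq> V" using assms by (simp add: loopless_independent_def)
  ultimately show ?thesis by (intro set_eqI) (auto simp only: V2_def V1_def Diff_iff Un_iff Int_iff mem_Collect_eq)
qed

text \<open>
  The loopless part of \<open>U\<close>, unless it is empty, is an independent set of the multigraph itself, so
  the condition applies to it; enlarging it to \<open>U\<close> can only increase the neighbourhood.
\<close>

lemma lingering_less: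
  assumes nc: "\<mu> \<in> Ncond V E" and U: "loopless_independent U" "U \<noteq> {}"
  shows "lingering U < mass (N U)"
proof (cases "U \<inter> V2 V E = {}")
  case True
  obtain x where "x \<in> U" using U by auto
  with U True show ?thesis using mass_N_pos[of x U] by (auto simp: loopless_independent_def)
next
  case False
  have "\<not> e \<subseteq> U \<inter> V2 V E" if "e \<in> E" for e
  proof -
    obtain a b where e: "e = {a, b}" using multigraph \<open>e \<in> E\<close> by (auto simp: multigraph_def)
    then have "adj E a b" using that by (simp add: adj_def)
    then show ?thesis using U(1)
      by (cases "a = b") (auto simp: e loopless_independent_def V2_def V1_def)
  qed
  then have "U \<inter> V2 V E \<in> independents V E"
    using False by (auto simp: independents_def V2_def)
  then have "lingering U < mass (N (U \<inter> V2 V E))" using nc by (simp add: Ncond_def)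
  also have "\<dots> \<le> mass (N U)" by (intro measure_pmf.finite_measure_mono N_mono) auto
  finally show ?thesis .
qed

text \<open>
  For \<open>U = {}\<close> the ratio is \<open>0 / 0 = 0\<close>, which is the right value: nothing can be repeated.
\<close>

lemma lingering_ratio:
  assumes nc: "\<mu> \<in> Ncond V E" and U: "loopless_independent U"
  shows "0 \<le> lingering U / mass (N U)" and "lingering U / mass (N U) < 1"
proof -
  show "0 \<le> lingering U / mass (N U)" by (intro divide_nonneg_nonneg measure_nonneg)
  show "lingering U / mass (N U) < 1"
  proof (cases "U = {}")
    case False
    then have l: "lingering U < mass (N U)" by (rule lingering_less[OF nc U])
    moreover have "0 \<le> lingering U" by (rule measure_nonneg)
    ultimately have "0 < mass (N U)" by linarith
    with l show ?thesis by (simp only: divide_less_eq_1_pos)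
  qed simp
qed

lemma weight_sum_Suc:
  assumes U: "loopless_independent U"
  shows "path_sum storable letter_weight (Suc n) U =
    lingering U / mass (N U) * path_sum storable letter_weight n U +
    (1 + (\<Sum>x\<in>fresh U. letter_weight x (insert x U) * path_sum storable letter_weight n (insert x U)))"
proof -
  let ?S = "\<lambda>U. path_sum storable letter_weight n U"
  let ?g = "\<lambda>x. letter_weight x (insert x U) * ?S (insert x U)"
  have "path_sum storable letter_weight (Suc n) U = 1 + sum ?g (storable U)"
    using finite_V by (intro path_sum_Suc) auto
  also have "sum ?g (storable U) = sum ?g (U \<inter> V2 V E) + sum ?g (fresh U)"
    unfolding storable_split[OF U] using finite_V
    by (intro sum.union_disjoint) (auto simp: V2_def)
  also have "sum ?g (U \<inter> V2 V E) = (\<Sum>x\<in>U \<inter> V2 V E. pmf \<mu> x) / mass (N U) * ?S U"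
    unfolding sum_divide_distrib sum_distrib_right
    by (rule sum.cong) (simp_all only: Int_iff insert_absorb)
  also have "(\<Sum>x\<in>U \<inter> V2 V E. pmf \<mu> x) = lingering U"
    using finite_V by (intro measure_measure_pmf_finite[symmetric]) (auto simp: V2_def)
  finally show ?thesis by linarith
qed

lemma weight_sum_incseq: "incseq (\<lambda>n. path_sum storable letter_weight n U)"
proof (rule incseq_SucI)
  fix n
  show "path_sum storable letter_weight n U \<le> path_sum storable letter_weight (Suc n) U"
    unfolding path_sum_def
  proof (intro sum_mono2 finite_paths[where V = V] finite_V)
    fix v assume "v \<in> {v. path_in storable U v \<and> length v \<le> Suc n} -
      {v. path_in storable U v \<and> length v \<le> n}"
    then have "set v \<subseteq> V" using path_in_subset[of storable V U v] by blast
    then show "weight U v \<ge> 0" by (rule less_imp_le[OF weight_pos])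
  qed auto
qed

text \<open>
  The recursion over the number of letters still available resolves the geometric series of
  repetitions, which turns the factor \<open>\<mu>(x) / \<mu>(N(W))\<close> of a new letter \<open>x\<close> into
  \<open>\<mu>(x) / (\<mu>(N(W)) - \<mu>(W \<inter> V\<^sub>2))\<close>.
\<close>

lemma weight_sum_tendsto:
  assumes nc: "\<mu> \<in> Ncond V E"
  shows "loopless_independent U \<Longrightarrow> card (V - U) \<le> m \<Longrightarrow>
    (\<lambda>n. path_sum storable letter_weight n U) \<longlonglongrightarrow>
      path_sum fresh fresh_weight m U / (1 - lingering U / mass (N U))"
proof (induction m arbitrary: U)
  case 0
  then have "fresh U = {}" using finite_V by auto
  then have "path_sum storable letter_weight (Suc n) U =
      lingering U / mass (N U) * path_sum storable letter_weight n U + 1" for n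
    unfolding weight_sum_Suc[OF 0(1)] \<open>fresh U = {}\<close> by simp
  moreover have "0 \<le> lingering U / mass (N U)" "lingering U / mass (N U) < 1"
    by (rule lingering_ratio[OF nc 0(1)])+
  ultimately show ?case
    using affine_recursion_tendsto[OF _ tendsto_const _ _ weight_sum_incseq, of U] by simp
next
  case (Suc m)
  let ?S = "path_sum storable letter_weight" and ?G = "path_sum fresh fresh_weight"
  have r: "0 \<le> lingering U / mass (N U)" "lingering U / mass (N U) < 1"
    by (rule lingering_ratio[OF nc Suc.prems(1)])+
  have lim: "(\<lambda>n. letter_weight x (insert x U) * ?S n (insert x U)) \<longlonglongrightarrow>
      fresh_weight x (insert x U) * ?G m (insert x U)" if x: "x \<in> fresh U" for x
  proof -
    let ?W = "insert x U"
    have W: "loopless_independent ?W" using Suc.prems x by (intro loopless_independent_insert)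
    have "V - ?W \<subset> V - U" using x by auto
    then have "card (V - ?W) < card (V - U)" using finite_V by (intro psubset_card_mono) auto
    then have lim: "(\<lambda>n. ?S n ?W) \<longlonglongrightarrow> ?G m ?W / (1 - lingering ?W / mass (N ?W))"
      using Suc.prems by (intro Suc.IH W) simp
    have "mass (N ?W) > 0" "lingering ?W < mass (N ?W)"
      using x lingering_less[OF nc W] by (auto intro: mass_N_pos)
    then have eq: "fresh_weight x ?W * ?G m ?W =
        letter_weight x ?W * (?G m ?W / (1 - lingering ?W / mass (N ?W)))"
      by (simp add: field_simps)
    show ?thesis unfolding eq by (rule tendsto_mult_left[OF lim])
  qed
  have "(\<lambda>n. 1 + (\<Sum>x\<in>fresh U. letter_weight x (insert x U) * ?S n (insert x U))) \<longlonglongrightarrow>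
      1 + (\<Sum>x\<in>fresh U. fresh_weight x (insert x U) * ?G m (insert x U))"
    by (intro tendsto_add tendsto_const tendsto_sum lim)
  also have "1 + (\<Sum>x\<in>fresh U. fresh_weight x (insert x U) * ?G m (insert x U)) = ?G (Suc m) U"
    using finite_V by (intro path_sum_Suc[symmetric]) auto
  finally show ?case
    by (rule affine_recursion_tendsto[OF weight_sum_Suc[OF Suc.prems(1)] _ r weight_sum_incseq])
qed

text \<open>
  A path of fresh letters has no repetition, so the length bound \<open>card V\<close> excludes none of them.
\<close>

definition partition_function :: real where
  "partition_function = path_sum fresh fresh_weight (card V) {}"

lemma invariant_weight_total:
  assumes nc: "\<mu> \<in> Ncond V E"
  shows "(\<integral>\<^sup>+w. ennreal (invariant_weight w) \<partial>count_space UNIV) = ennreal partition_function"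
proof -
  let ?A = "\<lambda>n. {w. path_in storable {} w \<and> length w \<le> n}"
  let ?F = "\<lambda>n w. ennreal (weight {} w) * indicator (?A n) w"
  have fin: "finite (?A n)" for n by (intro finite_paths[where V = V] finite_V) auto
  have wn: "weight {} w \<ge> 0" if "w \<in> ?A n" for w n
    using that path_in_subset[of storable V "{}" w] by (intro less_imp_le[OF weight_pos]) blast
  have sup: "ennreal (invariant_weight w) = (SUP n. ?F n w)" for w
  proof (cases "w \<in> admissible_words V E")
    case True
    have "?F (length w) w \<le> (SUP n. ?F n w)" by (intro SUP_upper) simp
    moreover have "(SUP n. ?F n w) \<le> ennreal (weight {} w)"
      by (intro SUP_least) (auto simp: indicator_def)
    ultimately show ?thesis using True
      by (simp add: invariant_weight_def admissible_iff_path)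
  next
    case False
    then show ?thesis by (simp add: invariant_weight_def admissible_iff_path)
  qed
  have "(\<integral>\<^sup>+w. ennreal (invariant_weight w) \<partial>count_space UNIV) =
      (SUP n. \<integral>\<^sup>+w. ?F n w \<partial>count_space UNIV)"
    unfolding sup
    by (intro nn_integral_monotone_convergence_SUP) (auto simp: incseq_def le_fun_def indicator_def)
  also have "\<dots> = (SUP n. ennreal (path_sum storable letter_weight n {}))"
  proof (intro SUP_cong refl)
    fix n
    show "(\<integral>\<^sup>+w. ?F n w \<partial>count_space UNIV) = ennreal (path_sum storable letter_weight n {})"
      using fin[of n] wn[of _ n]
      by (subst nn_integral_indicator_finite) (auto simp: path_sum_def intro!: sum_ennreal)
  qed
  also have "(SUP n. ennreal (path_sum storable letter_weight n {})) = ennreal partition_function"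
  proof (rule LIMSEQ_unique)
    show "(\<lambda>n. ennreal (path_sum storable letter_weight n {})) \<longlonglongrightarrow>
        (SUP n. ennreal (path_sum storable letter_weight n {}))"
      by (intro LIMSEQ_SUP) (use weight_sum_incseq in \<open>auto simp: incseq_def intro: ennreal_leI\<close>)
    show "(\<lambda>n. ennreal (path_sum storable letter_weight n {})) \<longlonglongrightarrow> ennreal partition_function"
      using weight_sum_tendsto[OF nc, of "{}" "card V"]
      by (intro tendsto_ennrealI) (simp add: loopless_independent_def partition_function_def)
  qed
  finally show ?thesis .
qed

lemma partition_function_pos:
  assumes nc: "\<mu> \<in> Ncond V E"
  shows "partition_function > 0"
proof -
  have "path_sum storable letter_weight 0 {} \<le> partition_function"
    using weight_sum_tendsto[OF nc, of "{}" "card V"]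
    by (intro incseq_le[OF weight_sum_incseq])
       (simp add: loopless_independent_def partition_function_def)
  then show ?thesis by simp
qed

lemma independents_loopless_iff:
  "I \<in> independents V (loopless E) \<longleftrightarrow> I \<noteq> {} \<and> loopless_independent I"
proof -
  have "(\<forall>e\<in>loopless E. \<not> e \<subseteq> I) \<longleftrightarrow> (\<forall>u\<in>I. \<forall>v\<in>I. u \<noteq> v \<longrightarrow> \<not> adj E u v)" (is "?L \<longleftrightarrow> ?R")
  proof
    assume ?L
    show ?R
    proof (intro ballI impI notI)
      fix u v assume uv: "u \<in> I" "v \<in> I" "u \<noteq> v" "adj E u v"
      then have "{u, v} \<in> loopless E" by (auto simp: loopless_def adj_def doubleton_eq_iff)
      with \<open>?L\<close> uv show False by auto
    qed
  next
    assume R: ?R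
    show ?L
    proof (intro ballI notI)
      fix e assume e: "e \<in> loopless E" "e \<subseteq> I"
      then obtain a b where "e = {a, b}" using multigraph by (auto simp: multigraph_def loopless_def)
      with e R show False by (auto simp: loopless_def adj_def)
    qed
  qed
  then show ?thesis by (auto simp: independents_def loopless_independent_def)
qed

lemma path_in_fresh_iff:
  "path_in fresh {} l \<longleftrightarrow> distinct l \<and> loopless_independent (set l)"
proof (induction l rule: rev_induct)
  case (snoc x l)
  then show ?case using adj_sym
    by (auto simp: path_in_snoc loopless_independent_def mem_N)
qed (simp add: loopless_independent_def)

text \<open>
  Injectivity is direct; surjectivity follows by counting, as both sides have \<open>card I\<close> factorial
  elements.
\<close>

lemma permutations_of_set_eq_image:
  assumes e: "bij_betw e {1..card I} I" and fin: "finite I"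
  shows "permutations_of_set I =
      (\<lambda>\<sigma>. map (\<lambda>i. e (\<sigma> i)) [1..<Suc (card I)]) ` {\<sigma>. \<sigma> permutes {1..card I}}" (is "_ = ?f ` ?P")
    and "inj_on (\<lambda>\<sigma>. map (\<lambda>i. e (\<sigma> i)) [1..<Suc (card I)]) {\<sigma>. \<sigma> permutes {1..card I}}"
proof -
  have set_upt: "set [1..<Suc (card I)] = {1..card I}" by auto
  show inj: "inj_on ?f ?P"
  proof (rule inj_onI, rule ext)
    fix \<sigma> \<tau> i assume \<sigma>: "\<sigma> \<in> ?P" and \<tau>: "\<tau> \<in> ?P" and eq: "?f \<sigma> = ?f \<tau>"
    show "\<sigma> i = \<tau> i"
    proof (cases "i \<in> {1..card I}")
      case True
      then have "e (\<sigma> i) = e (\<tau> i)" using eq by (simp only: map_eq_conv set_upt)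
      moreover have "\<rho> i \<in> {1..card I}" if "\<rho> permutes {1..card I}" for \<rho>
        using True by (simp only: permutes_in_image[OF that])
      ultimately show ?thesis
        using \<sigma> \<tau> by (intro inj_onD[OF bij_betw_imp_inj_on[OF e]]) simp_all
    next
      case False
      then show ?thesis using \<sigma> \<tau> by (simp add: permutes_def)
    qed
  qed
  have "?f ` ?P \<subseteq> permutations_of_set I"
  proof (intro image_subsetI permutations_of_setI)
    fix \<sigma> assume "\<sigma> \<in> ?P"
    then have b: "bij_betw (\<lambda>i. e (\<sigma> i)) {1..card I} I"
      using bij_betw_trans[OF permutes_imp_bij e] by (simp add: comp_def)
    show "set (?f \<sigma>) = I" using b set_upt by (simp only: set_map bij_betw_def)
    show "distinct (?f \<sigma>)" using b set_upt
      by (simp only: distinct_map distinct_upt bij_betw_def)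
  qed
  moreover have "card (?f ` ?P) = card (permutations_of_set I)"
    using inj fin by (simp add: card_image card_permutations)
  ultimately show "permutations_of_set I = ?f ` ?P"
    using fin by (metis card_subset_eq finite_permutations_of_set)
qed

lemma fcfm_alpha_eq:
  assumes e: "enumerates_independents V E e"
  shows "fcfm_alpha V E \<mu> e = 1 / partition_function"
proof -
  let ?P = "path_weight fresh_weight {}"
  let ?Is = "independents V (loopless E)"
  have finI: "finite I" if "I \<in> ?Is" for I
    using that finite_V finite_subset by (auto simp: independents_def)
  have finIs: "finite ?Is"
    using finite_V by (rule_tac finite_subset[of _ "Pow V"]) (auto simp: independents_def)
  have "{l. path_in fresh {} l \<and> length l \<le> card V} = insert [] (\<Union>I\<in>?Is. permutations_of_set I)"
  proof (intro set_eqI iffI)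
    fix l assume "l \<in> {l. path_in fresh {} l \<and> length l \<le> card V}"
    then show "l \<in> insert [] (\<Union>I\<in>?Is. permutations_of_set I)"
      by (cases "l = []") (auto simp: path_in_fresh_iff independents_loopless_iff permutations_of_set_def)
  next
    fix l assume "l \<in> insert [] (\<Union>I\<in>?Is. permutations_of_set I)"
    moreover have "length l \<le> card V" if "distinct l" "set l \<subseteq> V"
      using that finite_V by (metis card_mono distinct_card)
    ultimately show "l \<in> {l. path_in fresh {} l \<and> length l \<le> card V}"
      by (auto simp: path_in_fresh_iff independents_loopless_iff permutations_of_set_def loopless_independent_def)
  qed
  then have "partition_function = (\<Sum>l\<in>insert [] (\<Union>I\<in>?Is. permutations_of_set I). ?P l)"
    by (simp add: partition_function_def path_sum_def)
  also have "\<dots> = 1 + (\<Sum>l\<in>(\<Union>I\<in>?Is. permutations_of_set I). ?P l)"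
  proof (subst sum.insert)
    show "[] \<notin> (\<Union>I\<in>?Is. permutations_of_set I)"
      by (auto simp: permutations_of_set_def independents_def)
  qed (use finIs in auto)
  also have "(\<Sum>l\<in>(\<Union>I\<in>?Is. permutations_of_set I). ?P l) = (\<Sum>I\<in>?Is. \<Sum>l\<in>permutations_of_set I. ?P l)"
    by (intro sum.UNION_disjoint finIs ballI impI finite_permutations_of_set)
       (auto simp: permutations_of_set_def)
  also have "\<dots> = (\<Sum>I\<in>?Is. \<Sum>\<sigma> | \<sigma> permutes {1..card I}. \<Prod>i=1..card I.
      pmf \<mu> (e I (\<sigma> i)) / (mass (N ((\<lambda>j. e I (\<sigma> j)) ` {1..i})) -
         mass ((\<lambda>j. e I (\<sigma> j)) ` {1..i} \<inter> V2 V E)))"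
  proof (intro sum.cong refl)
    fix I assume I: "I \<in> ?Is"
    have b: "bij_betw (e I) {1..card I} I" using e I by (simp add: enumerates_independents_def)
    let ?f = "\<lambda>\<sigma>. map (\<lambda>i. e I (\<sigma> i)) [1..<Suc (card I)]"
    have P: "?P (?f \<sigma>) = (\<Prod>i=1..card I.
      pmf \<mu> (e I (\<sigma> i)) / (mass (N ((\<lambda>j. e I (\<sigma> j)) ` {1..i})) -
         mass ((\<lambda>j. e I (\<sigma> j)) ` {1..i} \<inter> V2 V E)))" for \<sigma>
    proof -
      have "set (take i (?f \<sigma>)) = (\<lambda>j. e I (\<sigma> j)) ` {1..i}" if "i \<in> {1..card I}" for i
      proof -
        have "take i (?f \<sigma>) = map (\<lambda>i. e I (\<sigma> i)) [1..<Suc i]"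
          using that by (auto simp: take_map take_upt simp del: upt_Suc)
        moreover have "set [1..<Suc i] = {1..i}" by auto
        ultimately show ?thesis by (simp only: set_map)
      qed
      moreover have "?f \<sigma> ! (i - 1) = e I (\<sigma> i)" if "i \<in> {1..card I}" for i
        using that by (auto simp del: upt_Suc)
      moreover have "length (?f \<sigma>) = card I" by simp
      ultimately show ?thesis
        unfolding path_weight_eq_prod by (intro prod.cong) (simp_all only: Un_empty_left)
    qed
    show "(\<Sum>l\<in>permutations_of_set I. ?P l) = (\<Sum>\<sigma> | \<sigma> permutes {1..card I}. \<Prod>i=1..card I.
      pmf \<mu> (e I (\<sigma> i)) / (mass (N ((\<lambda>j. e I (\<sigma> j)) ` {1..i})) -
         mass ((\<lambda>j. e I (\<sigma> j)) ` {1..i} \<inter> V2 V E)))"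
      unfolding permutations_of_set_eq_image(1)[OF b finI[OF I]]
      by (subst sum.reindex[OF permutations_of_set_eq_image(2)[OF b finI[OF I]]])
         (simp only: comp_def P)
  qed
  finally show ?thesis by (simp add: fcfm_alpha_def divide_inverse)
qed

lemma ex_fcfm_stationary:
  assumes nc: "\<mu> \<in> Ncond V E"
  shows "\<exists>\<pi>. fcfm_stationary V E \<mu> \<pi> \<and> (\<forall>w. pmf \<pi> w = invariant_weight w / partition_function)"
proof -
  note Z = partition_function_pos[OF nc]
  let ?f = "\<lambda>w. invariant_weight w / partition_function"
  have "(\<integral>\<^sup>+w. ennreal (?f w) \<partial>count_space UNIV) =
      (\<integral>\<^sup>+w. ennreal (invariant_weight w) / ennreal partition_function \<partial>count_space UNIV)"
    using Z by (intro nn_integral_cong) (simp add: divide_ennreal invariant_weight_nonneg)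
  also have "\<dots> = 1"
    using Z by (simp add: nn_integral_divide invariant_weight_total[OF nc] ennreal_divide_self)
  finally have "pmf (embed_pmf ?f) w = ?f w" for w
    using Z by (intro pmf_embed_pmf) (auto simp: invariant_weight_nonneg)
  then show ?thesis using fcfm_stationaryI[OF _ Z] by blast
qed

section \<open>Return times\<close>

abbreviation "step \<equiv> fcfm_step V E"
abbreviation "chain \<equiv> fcfm_chain V E"
abbreviation "arrivals \<equiv> stream_space (measure_pmf \<mu>)"

text \<open>
  Almost surely all arrivals lie in \<open>V\<close>, but the type of classes may be uncountable, which puts the
  measurability of the chain as a function of all arrivals in doubt. An arrival outside \<open>V\<close> has no neighbour, so it stays in the buffer for ever. Hence a word over \<open>V\<close> can only
  be reached by arrivals from the finite set \<open>V\<close>, which makes the event of reaching it a finite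
  union of cylinders and thereby measurable.
\<close>

lemma outside_persists:
  assumes "x \<in> set w \<or> x = c" and "x \<notin> V"
  shows "x \<in> set (step w c)"
proof (cases rule: fcfm_step_cases[of w c])
  case (matched u y v)
  then show ?thesis using assms adj_V[of c y] by auto
qed (use assms in auto)

lemma arrivals_in_V:
  assumes "set (chain w C n) \<subseteq> V" and "k < n"
  shows "C !! k \<in> V"
proof (rule ccontr)
  assume out: "C !! k \<notin> V"
  have "C !! k \<in> set (chain w C n)" using \<open>k < n\<close>
  proof (induction n)
    case (Suc n)
    then show ?case using outside_persists[OF _ out] by (auto simp: less_Suc_eq)
  qed simp
  then show False using assms out by blast
qed

lemma chain_eq_foldl: "chain w C n = foldl step w (stake n C)"
  by (induction n) (simp_all add: stake_Suc del: stake.simps(2))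

lemma chain_SCons: "chain w (c ## C) (Suc n) = chain (step w c) C n"
  by (simp only: chain_eq_foldl stake.simps stream.sel foldl.simps)

lemma sets_chain_eq:
  assumes w0: "set w0 \<subseteq> V"
  shows "{C. chain w C n = w0} \<in> sets arrivals"
proof -
  let ?U = "{u. set u \<subseteq> V \<and> length u = n \<and> foldl step w u = w0}"
  have "{C. chain w C n = w0} = (\<Union>u\<in>?U. {C. \<forall>i<n. C !! i = u ! i})"
  proof (intro set_eqI iffI)
    fix C assume C: "C \<in> {C. chain w C n = w0}"
    then have "stake n C \<in> ?U"
      using w0 arrivals_in_V[of w C n] by (auto simp: chain_eq_foldl set_conv_nth)
    then show "C \<in> (\<Union>u\<in>?U. {C. \<forall>i<n. C !! i = u ! i})" by (intro UN_I[of "stake n C"]) auto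
  next
    fix C assume "C \<in> (\<Union>u\<in>?U. {C. \<forall>i<n. C !! i = u ! i})"
    then obtain u where u: "u \<in> ?U" "\<forall>i<n. C !! i = u ! i" by blast
    then have "stake n C = u" by (intro nth_equalityI) auto
    then show "C \<in> {C. chain w C n = w0}" using u by (simp add: chain_eq_foldl)
  qed
  also have "\<dots> \<in> sets arrivals"
  proof (intro sets.finite_UN)
    show "finite ?U"
      using finite_lists_length_eq[OF finite_V, of n] by (rule rev_finite_subset) auto
    fix u
    have "{C \<in> space arrivals. \<forall>i<n. C !! i = u ! i} \<in> sets arrivals" by measurable
    then show "{C. \<forall>i<n. C !! i = u ! i} \<in> sets arrivals" by (simp add: space_stream_space)
  qed
  finally show ?thesis .
qed

lemma sets_no_return:
  assumes "set w0 \<subseteq> V"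
  shows "{C. \<forall>k\<in>{1..n}. chain w C k \<noteq> w0} \<in> sets arrivals"
proof -
  have "{C. \<forall>k\<in>{1..n}. chain w C k \<noteq> w0} = space arrivals - (\<Union>k\<in>{1..n}. {C. chain w C k = w0})"
    by (auto simp: space_stream_space)
  then show ?thesis using sets_chain_eq[OF assms] by auto
qed

text \<open>
  The probability of no visit to \<open>w0\<close> at the times \<open>1, \<dots>, n\<close>, starting from \<open>w\<close>. The start itself is
  not counted as a visit, so that \<open>w = w0\<close> gives the tail of the return time.
\<close>

primrec survival :: "'a list \<Rightarrow> nat \<Rightarrow> 'a list \<Rightarrow> real" where
  "survival w0 0 w = 1"
| "survival w0 (Suc n) w =
    (\<integral>c. (if step w c = w0 then 0 else survival w0 n (step w c)) \<partial>measure_pmf \<mu>)"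

lemma survival_nonneg: "survival w0 n w \<ge> 0"
  by (induction n arbitrary: w) (auto intro!: integral_nonneg_AE)

lemma integrable_arrival: "integrable (measure_pmf \<mu>) (f :: 'a \<Rightarrow> real)"
  using support finite_V by (intro integrable_measure_pmf_finite) simp

lemma ennreal_survival_Suc:
  "ennreal (survival w0 (Suc n) w) =
    (\<integral>\<^sup>+c. ennreal (if step w c = w0 then 0 else survival w0 n (step w c)) \<partial>measure_pmf \<mu>)"
  unfolding survival.simps
  by (rule nn_integral_eq_integral[symmetric]) (auto intro!: integrable_arrival survival_nonneg)

lemma emeasure_no_return:
  assumes w0: "set w0 \<subseteq> V"
  shows "emeasure arrivals {C. \<forall>k\<in>{1..n}. chain w C k \<noteq> w0} = ennreal (survival w0 n w)"
proof (induction n arbitrary: w)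
  case 0
  interpret prob_space arrivals by (rule prob_space.prob_space_stream_space[OF measure_pmf.prob_space_axioms])
  show ?case using emeasure_space_1 by (simp add: space_stream_space)
next
  case (Suc n)
  let ?X = "{C. \<forall>k\<in>{1..Suc n}. chain w C k \<noteq> w0}"
  have "{C \<in> space arrivals. c ## C \<in> ?X} =
      (if step w c = w0 then {} else {C. \<forall>k\<in>{1..n}. chain (step w c) C k \<noteq> w0})" for c
  proof -
    have "(\<forall>k\<in>{1..Suc n}. chain w (c ## C) k \<noteq> w0) \<longleftrightarrow> (\<forall>k\<in>{0..n}. chain (step w c) C k \<noteq> w0)" for C
      unfolding One_nat_def image_Suc_atLeastAtMost[symmetric] chain_SCons[symmetric] by blast
    moreover have "{0..n} = insert 0 {1..n}" by auto
    ultimately show ?thesis by (auto simp: space_stream_space)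
  qed
  then have "emeasure arrivals ?X =
      (\<integral>\<^sup>+c. ennreal (if step w c = w0 then 0 else survival w0 n (step w c)) \<partial>measure_pmf \<mu>)"
    unfolding prob_space.emeasure_stream_space[OF measure_pmf.prob_space_axioms sets_no_return[OF w0]]
    by (intro nn_integral_cong) (simp add: Suc.IH[simplified])
  then show ?case by (simp only: ennreal_survival_Suc)
qed

lemma less_return_time_iff: "enat n < return_time X x \<longleftrightarrow> (\<forall>k\<in>{1..n}. X k \<noteq> x)"
proof
  assume l: "enat n < return_time X x"
  show "\<forall>k\<in>{1..n}. X k \<noteq> x"
  proof (intro ballI notI)
    fix k assume "k \<in> {1..n}" "X k = x"
    then have "return_time X x \<le> enat k" unfolding return_time_def by (intro INF_lower) auto
    also have "\<dots> \<le> enat n" using \<open>k \<in> {1..n}\<close> by simp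
    finally show False using l by simp
  qed
next
  assume no: "\<forall>k\<in>{1..n}. X k \<noteq> x"
  have "enat (Suc n) \<le> return_time X x"
    unfolding return_time_def
  proof (rule INF_greatest)
    fix k assume "k \<in> {k. k \<ge> 1 \<and> X k = x}"
    with no have "\<not> k \<le> n" by auto
    then show "enat (Suc n) \<le> enat k" by simp
  qed
  then show "enat n < return_time X x" by (meson enat_ord_simps(2) less_le_trans lessI)
qed

lemma expected_return_time_eq:
  assumes w0: "set w0 \<subseteq> V"
  shows "expected_return_time V E \<mu> w0 = (\<Sum>n. ennreal (survival w0 n w0))"
proof -
  let ?T = "\<lambda>C. return_time (chain w0 C) w0"
  have gt: "{C \<in> space arrivals. enat n < ?T C} = {C. \<forall>k\<in>{1..n}. chain w0 C k \<noteq> w0}" for n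
    by (simp add: less_return_time_iff space_stream_space)
  have [measurable]: "Measurable.pred arrivals (\<lambda>C. enat n < ?T C)" for n
    unfolding pred_def gt by (rule sets_no_return[OF w0])
  have "?T \<in> measurable arrivals (count_space UNIV)"
  proof (subst measurable_count_space_eq2_countable, intro conjI ballI)
    fix a :: enat
    have "?T C = a \<longleftrightarrow> (\<forall>n. enat n < ?T C \<longleftrightarrow> enat n < a)" for C
    proof
      assume l: "\<forall>n. enat n < ?T C \<longleftrightarrow> enat n < a"
      then have "\<not> ?T C < a" by (cases "?T C") auto
      moreover have "\<not> a < ?T C" using l by (cases a) auto
      ultimately show "?T C = a" by (simp only: not_less order.antisym)
    qed simp
    then have "?T -` {a} \<inter> space arrivals = {C \<in> space arrivals. \<forall>n. enat n < ?T C \<longleftrightarrow> enat n < a}"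
      by auto
    also have "\<dots> \<in> sets arrivals" by measurable
    finally show "?T -` {a} \<inter> space arrivals \<in> sets arrivals" .
  qed auto
  then have "expected_return_time V E \<mu> w0 = (\<Sum>n. emeasure arrivals {C \<in> space arrivals. enat n < ?T C})"
    unfolding expected_return_time_def by (rule nn_integral_enat_function)
  then show ?thesis by (simp only: gt emeasure_no_return[OF w0])
qed

text \<open>
  Let \<open>I n\<close> be the probability of no visit to \<open>w0\<close> at the times \<open>1, \<dots>, n\<close> under the stationary
  chain. By stationarity, \<open>I (n + 1)\<close> is also the probability of no visit at the times \<open>0, \<dots>, n\<close>.
  Therefore \<open>I n - I (n + 1)\<close> is the probability of starting at \<open>w0\<close> and not returning within
  \<open>n\<close> steps, and the sum telescopes to at most \<open>I 0 = 1\<close>.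
\<close>

lemma kac_bound:
  assumes st: "fcfm_stationary V E \<mu> \<pi>"
  shows "pmf \<pi> w0 * (\<Sum>n<m. survival w0 n w0) \<le> 1"
proof -
  define I where "I n = (\<integral>\<^sup>+w. ennreal (survival w0 n w) \<partial>measure_pmf \<pi>)" for n
  have I_Suc: "I n = ennreal (pmf \<pi> w0 * survival w0 n w0) + I (Suc n)" for n
  proof -
    let ?h = "\<lambda>w. ennreal (if w = w0 then 0 else survival w0 n w)"
    have "I (Suc n) = (\<integral>\<^sup>+w. \<integral>\<^sup>+c. ?h (step w c) \<partial>measure_pmf \<mu> \<partial>measure_pmf \<pi>)"
      unfolding I_def ennreal_survival_Suc ..
    also have "\<dots> = (\<integral>\<^sup>+w. ?h w \<partial>measure_pmf (bind_pmf \<pi> (fcfm_kernel V E \<mu>)))"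
      by (simp add: fcfm_kernel_def)
    also have "\<dots> = (\<integral>\<^sup>+w. ?h w \<partial>measure_pmf \<pi>)"
      using st by (simp add: fcfm_stationary_def)
    finally have Suc_eq: "I (Suc n) = (\<integral>\<^sup>+w. ?h w \<partial>measure_pmf \<pi>)" .
    have "I n = (\<integral>\<^sup>+w. ennreal (survival w0 n w0) * indicator {w0} w + ?h w \<partial>measure_pmf \<pi>)"
      unfolding I_def by (intro nn_integral_cong) (simp add: indicator_def)
    also have "\<dots> = ennreal (survival w0 n w0) * emeasure \<pi> {w0} + (\<integral>\<^sup>+w. ?h w \<partial>measure_pmf \<pi>)"
      by (subst nn_integral_add) (auto simp: nn_integral_cmult_indicator)
    finally show ?thesis
      by (simp add: Suc_eq emeasure_pmf_single ennreal_mult[symmetric] survival_nonneg mult.commute)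
  qed
  have total: "I 0 = ennreal (pmf \<pi> w0 * (\<Sum>n<m. survival w0 n w0)) + I m"
  proof (induction m)
    case (Suc m)
    have "0 \<le> pmf \<pi> w0 * (\<Sum>n<m. survival w0 n w0)" "0 \<le> pmf \<pi> w0 * survival w0 m w0"
      by (auto intro!: mult_nonneg_nonneg sum_nonneg survival_nonneg)
    then show ?case
      using Suc I_Suc[of m] by (simp add: distrib_left ennreal_plus add.assoc)
  qed simp
  have "ennreal (pmf \<pi> w0 * (\<Sum>n<m. survival w0 n w0)) \<le> I 0"
    unfolding total by (intro add_increasing2 order_refl) simp
  also have "I 0 = 1" by (simp add: I_def)
  finally show ?thesis by (simp add: ennreal_le_1)
qed

lemma expected_return_time_finite:
  assumes st: "fcfm_stationary V E \<mu> \<pi>" and pos: "pmf \<pi> w0 > 0" and w0: "set w0 \<subseteq> V"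
  shows "expected_return_time V E \<mu> w0 < \<infinity>"
proof -
  have "(\<Sum>n<m. ennreal (survival w0 n w0)) \<le> ennreal (1 / pmf \<pi> w0)" for m
    using kac_bound[OF st, of w0 m] pos
    by (simp add: sum_ennreal survival_nonneg field_simps ennreal_leI)
  then have "(\<Sum>n. ennreal (survival w0 n w0)) \<le> ennreal (1 / pmf \<pi> w0)"
    by (intro suminf_le_const summableI)
  also have "\<dots> < \<infinity>" by simp
  finally show ?thesis by (simp only: expected_return_time_eq[OF w0])
qed

section \<open>Necessity of the condition\<close>

text \<open>
  The change of the imbalance when an arrival of class \<open>c\<close> is stored.
\<close>

definition drift :: "'a set \<Rightarrow> 'a \<Rightarrow> real" where
  "drift I c = indicator I c - indicator (N I) c"

definition imbalance :: "'a set \<Rightarrow> 'a list \<Rightarrow> real" where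
  "imbalance I w = (\<Sum>c\<leftarrow>w. drift I c)"

lemma independent_disjoint:
  assumes "I \<in> independents V E"
  shows "I \<inter> N I = {}"
  using assms by (fastforce simp: independents_def mem_N adj_def)

lemma drift_adj:
  assumes "I \<in> independents V E" and "adj E c x"
  shows "drift I c + drift I x \<le> 0"
  using independent_disjoint[OF assms(1)] assms(2) adj_sym
  by (auto simp: drift_def indicator_def mem_N)

text \<open>
  Equality holds if the arrival is stored. If it is matched, the removed item contributes minus its
  own drift, and adjacent classes have drifts of sum at most zero because neighbours of \<open>I\<close> lie in
  \<open>N(I)\<close>. The inequality is strict when a class of \<open>N(I)\<close> is matched with one outside \<open>I\<close>.
\<close>

lemma imbalance_step:
  assumes I: "I \<in> independents V E"
  shows "imbalance I w + drift I c \<le> imbalance I (step w c)"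
proof (cases rule: fcfm_step_cases[of w c])
  case stored
  then show ?thesis by (simp add: imbalance_def)
next
  case (matched u x v)
  then show ?thesis using drift_adj[OF I matched(3)] by (simp add: imbalance_def)
qed

lemma length_step: "length (step w c) \<le> Suc (length w)"
  by (cases rule: fcfm_step_cases[of w c]) auto

lemma imbalance_le_length: "imbalance I w \<le> length w"
proof (induction w)
  case (Cons c w)
  have "drift I c \<le> 1" by (simp add: drift_def indicator_def)
  then show ?case using Cons by (simp add: imbalance_def)
qed (simp add: imbalance_def)

lemma integral_drift: "(\<integral>c. drift I c \<partial>measure_pmf \<mu>) = mass I - mass (N I)"
  unfolding drift_def
  by (subst Bochner_Integration.integral_diff) (simp_all add: integrable_arrival)

text \<open>
  The empty word has imbalance zero, so only the steps that avoid it contribute to the mean.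
\<close>

lemma mean_imbalance_step_le:
  assumes bound: "\<And>w. imbalance I w \<le> (length w + n) * survival [] n w"
  shows "(\<integral>c. imbalance I (step w c) \<partial>measure_pmf \<mu>) \<le> (length w + Suc n) * survival [] (Suc n) w"
proof -
  let ?g = "\<lambda>c. if step w c = [] then 0 else survival [] n (step w c)"
  have "imbalance I (step w c) \<le> (length w + Suc n) * ?g c" for c
  proof (cases "step w c = []")
    case False
    have "imbalance I (step w c) \<le> (length (step w c) + n) * survival [] n (step w c)"
      by (rule bound)
    also have "\<dots> \<le> (length w + Suc n) * survival [] n (step w c)"
      using length_step[of w c] by (intro mult_right_mono survival_nonneg) simp
    finally show ?thesis using False by simp
  qed (simp add: imbalance_def)
  then have "(\<integral>c. imbalance I (step w c) \<partial>measure_pmf \<mu>) \<le>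
      (\<integral>c. (length w + Suc n) * ?g c \<partial>measure_pmf \<mu>)"
    by (intro integral_mono integrable_arrival)
  then show ?thesis by simp
qed

text \<open>
  Stopped at the first visit to the empty word at a positive time, the imbalance is a submartingale
  that vanishes upon that visit. After \<open>n\<close> steps it is at most \<open>length w + n\<close>, and nonzero only if
  the empty word has been avoided at the times \<open>1, \<dots>, n\<close>.
\<close>

lemma imbalance_le_survival:
  assumes I: "I \<in> independents V E" and le: "mass (N I) \<le> mass I"
  shows "imbalance I w \<le> (length w + n) * survival [] n w"
proof (induction n arbitrary: w)
  case 0
  then show ?case by (simp add: imbalance_le_length)
next
  case (Suc n)
  have "imbalance I w \<le> (\<integral>c. imbalance I w + drift I c \<partial>measure_pmf \<mu>)"
    using le by (subst Bochner_Integration.integral_add) (simp_all add: integral_drift integrable_arrival)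
  also have "\<dots> \<le> (\<integral>c. imbalance I (step w c) \<partial>measure_pmf \<mu>)"
    by (intro integral_mono integrable_arrival imbalance_step I)
  also have "\<dots> \<le> (length w + Suc n) * survival [] (Suc n) w"
    by (rule mean_imbalance_step_le[OF Suc])
  finally show ?case .
qed

text \<open>
  From the empty word, the arrival of \<open>x\<close> followed by that of \<open>y\<close> empties the buffer again. The
  drifts of these arrivals sum to at most \<open>- 1\<close>, whereas the imbalance is back at zero. This gain,
  which occurs with probability \<open>\<mu>(x) \<mu>(y)\<close>, persists in the submartingale estimate.
\<close>

lemma survival_lower_bound:
  assumes I: "I \<in> independents V E" and le: "mass (N I) \<le> mass I"
    and x: "x \<in> N I" and y: "y \<notin> I" and xy: "adj E x y"
  shows "pmf \<mu> x * pmf \<mu> y \<le> (real n + 2) * survival [] (n + 2) []"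
proof -
  have one: "imbalance I [c] = drift I c" for c by (simp add: imbalance_def)
  have pt: "drift I c + pmf \<mu> y * indicator {x} c \<le> (real n + 2) * survival [] (Suc n) [c]" for c
  proof (cases "c = x")
    case True
    have gx: "drift I x = -1" using x independent_disjoint[OF I] by (auto simp: drift_def indicator_def)
    have "drift I x + pmf \<mu> y \<le> drift I x + (mass I - mass (N I)) + pmf \<mu> y" using le by simp
    also have "\<dots> = (\<integral>d. drift I x + drift I d + indicator {y} d \<partial>measure_pmf \<mu>)"
      by (simp add: Bochner_Integration.integral_add integrable_arrival integral_drift measure_pmf_single)
    also have "\<dots> \<le> (\<integral>d. imbalance I (step [x] d) \<partial>measure_pmf \<mu>)"
    proof (intro integral_mono integrable_arrival)
      fix d
      show "drift I x + drift I d + indicator {y} d \<le> imbalance I (step [x] d)"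
      proof (cases "d = y")
        case True
        \<comment> \<open>The arrival \<open>y\<close> meets the stored \<open>x\<close> and the buffer is empty: a gain of at least one.\<close>
        have "step [x] y = []" using fcfm_step_matched[of "[]" y x "[]"] xy adj_sym by auto
        then show ?thesis using True gx y by (simp add: imbalance_def drift_def indicator_def)
      next
        case False
        then show ?thesis using imbalance_step[OF I, of "[x]" d] by (simp add: one)
      qed
    qed
    also have "\<dots> \<le> (length [x] + Suc n) * survival [] (Suc n) [x]"
      by (rule mean_imbalance_step_le[OF imbalance_le_survival[OF I le]])
    finally show ?thesis using True by (simp add: add.commute)
  next
    case False
    then show ?thesis using imbalance_le_survival[OF I le, of "[c]" "Suc n"]
      by (simp add: one add.commute)
  qed
  have "pmf \<mu> x * pmf \<mu> y \<le> mass I - mass (N I) + pmf \<mu> y * pmf \<mu> x" using le by simp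
  also have "\<dots> = (\<integral>c. drift I c + pmf \<mu> y * indicator {x} c \<partial>measure_pmf \<mu>)"
    by (simp add: Bochner_Integration.integral_add integrable_arrival integral_drift measure_pmf_single)
  also have "\<dots> \<le> (\<integral>c. (real n + 2) * survival [] (Suc n) [c] \<partial>measure_pmf \<mu>)"
    using pt by (intro integral_mono integrable_arrival)
  also have "\<dots> = (real n + 2) * survival [] (n + 2) []"
  proof -
    have "step [] c = [c]" for c by (simp add: fcfm_step_def)
    then show ?thesis by simp
  qed
  finally show ?thesis .
qed

text \<open>
  Otherwise \<open>I \<union> N(I)\<close> is closed under adjacency, hence all of \<open>V\<close>, and \<open>I\<close> and \<open>N(I)\<close> are the
  two sides of a bipartition.
\<close>

lemma escaping_edge:
  assumes con: "graph_connected V E" and nb: "\<not> bipartite V E" and I: "I \<in> independents V E"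
  obtains x y where "x \<in> N I" "y \<notin> I" "adj E x y"
proof (cases "\<forall>x\<in>N I. \<forall>y. adj E x y \<longrightarrow> y \<in> I")
  case True
  note closed = True
  have dis: "I \<inter> N I = {}" by (rule independent_disjoint[OF I])
  have IV: "I \<subseteq> V" "I \<noteq> {}" using I by (auto simp: independents_def)
  then obtain u where u: "u \<in> I" by blast
  have reach: "v \<in> I \<union> N I" if "(adj E)\<^sup>*\<^sup>* u v" for v
    using that
  proof induction
    case base
    then show ?case using u by simp
  next
    case (step v v')
    then show ?case using True by (auto simp: mem_N)
  qed
  have V: "I \<union> N I = V"
  proof
    show "I \<union> N I \<subseteq> V" using IV N_subset by blast
    show "V \<subseteq> I \<union> N I" using reach con u IV unfolding graph_connected_def by blast
  qed
  have "V1 V E = {}"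
  proof -
    have "\<not> adj E v v" if "v \<in> V" for v
      using that True dis V mem_N[of v I] by blast
    then show ?thesis by (auto simp: V1_def)
  qed
  moreover have "\<exists>a\<in>I. \<exists>b\<in>N I. e = {a, b}" if "e \<in> E" for e
  proof -
    obtain a b where e: "e = {a, b}" "a \<in> V" "b \<in> V"
      using multigraph \<open>e \<in> E\<close> by (auto simp: multigraph_def)
    then have ab: "adj E a b" using that by (simp add: adj_def)
    show ?thesis
    proof (cases "a \<in> I")
      case True
      then have "b \<in> N I" using ab mem_N by blast
      then show ?thesis using True e(1) by blast
    next
      case False
      then have "a \<in> N I" using e V by auto
      moreover from this have "b \<in> I" using closed ab by blast
      moreover have "e = {b, a}" using e(1) by (simp add: insert_commute)
      ultimately show ?thesis by blast
    qed
  qed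
  ultimately have "bipartite V E" using dis V unfolding bipartite_def by blast
  then show ?thesis using nb by simp
qed (use that in blast)

text \<open>
  If the condition fails, \<open>survival_lower_bound\<close> bounds the tails of the return time to the empty
  word below by a multiple of the harmonic series.
\<close>

lemma stable_imp_Ncond:
  assumes con: "graph_connected V E" and nb: "\<not> bipartite V E"
    and fin: "expected_return_time V E \<mu> [] < \<infinity>"
  shows "\<mu> \<in> Ncond V E"
proof (rule ccontr)
  assume "\<mu> \<notin> Ncond V E"
  then obtain I where I: "I \<in> independents V E" and le: "mass (N I) \<le> mass I"
    using support by (auto simp: Ncond_def full_support_measures_def not_less)
  obtain x y where xy: "x \<in> N I" "y \<notin> I" "adj E x y"
    by (rule escaping_edge[OF con nb I])
  define \<epsilon> where "\<epsilon> = pmf \<mu> x * pmf \<mu> y"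
  have \<epsilon>: "\<epsilon> > 0" using adj_V[OF xy(3)] support by (simp add: \<epsilon>_def pmf_positive)
  have "summable (\<lambda>n. survival [] n [])"
    using fin survival_nonneg by (intro summable_suminf_not_top) (auto simp: expected_return_time_eq)
  then have "summable (\<lambda>n. survival [] (n + 2) [])" by (rule summable_ignore_initial_segment)
  then have "summable (\<lambda>n. \<epsilon> * (1 / real (n + 2)))"
  proof (rule summable_comparison_test'[where N = 0])
    fix n
    show "norm (\<epsilon> * (1 / real (n + 2))) \<le> survival [] (n + 2) []"
      using survival_lower_bound[OF I le xy, of n] \<epsilon>
      by (simp add: \<epsilon>_def[symmetric] field_simps del: survival.simps add_2_eq_Suc')
  qed
  then have "summable (\<lambda>n. 1 / real (n + 2))"
    using \<epsilon> by (subst (asm) summable_cmult_iff) simp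
  then have "summable (\<lambda>n. 1 / real n)" by (rule summable_iff_shift[THEN iffD1])
  then show False
    using not_summable_harmonic[where 'a = real] by (simp add: inverse_eq_divide)
qed

end

text \<open>
  An isolated class of a connected graph is the only one, and a single node without a self-loop is
  a bipartite graph with one empty side.
\<close>

lemma connected_imp_neighbour:
  assumes mg: "multigraph V E" and con: "graph_connected V E" and nb: "\<not> bipartite V E" and u: "u \<in> V"
  shows "\<exists>v\<in>V. adj E u v"
proof (rule ccontr)
  assume no: "\<not> (\<exists>v\<in>V. adj E u v)"
  have edge: "\<exists>a\<in>V. \<exists>b\<in>V. e = {a, b}" if "e \<in> E" for e
    using mg that by (auto simp: multigraph_def)
  have no': "\<not> adj E u v" for v
    using no edge by (fastforce simp: adj_def doubleton_eq_iff)
  have "v = u" if "v \<in> V" for v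
  proof -
    have "(adj E)\<^sup>*\<^sup>* u v" using con u that by (auto simp: graph_connected_def)
    then show ?thesis using no' by (metis converse_rtranclpE)
  qed
  then have V: "V = {u}" using u by blast
  have "e \<notin> E" for e
  proof
    assume "e \<in> E"
    then obtain a b where "a \<in> V" "b \<in> V" "e = {a, b}" using edge by blast
    then show False using no'[of u] \<open>e \<in> E\<close> by (simp add: V adj_def)
  qed
  then have "bipartite V E"
    unfolding bipartite_def V1_def adj_def by (intro conjI exI[of _ V] exI[of _ "{}"]) simp_all
  with nb show False by simp
qed

section \<open>Maximality of first come, first matched\<close>

theorem theorem5p1:
  fixes V :: "'a set" and E :: "'a set set"
  assumes "multigraph V E" and "graph_connected V E" and "\<not> bipartite V E"
  shows "Stab_fcfm V E = Ncond V E \<and>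
    (\<forall>\<mu>\<in>Ncond V E.
       (\<exists>!\<pi>. fcfm_stationary V E \<mu> \<pi>) \<and>
       (\<forall>\<pi> e. fcfm_stationary V E \<mu> \<pi> \<and> enumerates_independents V E e \<longrightarrow>
          pmf \<pi> [] = fcfm_alpha V E \<mu> e \<and>
          (\<forall>w\<in>admissible_words V E - {[]}.
             pmf \<pi> w = fcfm_alpha V E \<mu> e *
               (\<Prod>l=1..length w.
                  pmf \<mu> (w ! (l - 1)) / measure_pmf.prob \<mu> (nbhd V E (set (take l w)))))))"
proof -
  have model: "matching_model V E \<mu>" if "set_pmf \<mu> = V" for \<mu>
    using that assms(1) connected_imp_neighbour[OF assms] by unfold_locales auto
  have supp: "set_pmf \<mu> = V" if "\<mu> \<in> Ncond V E \<or> \<mu> \<in> Stab_fcfm V E" for \<mu>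
    using that by (auto simp: Ncond_def Stab_fcfm_def full_support_measures_def)
  have "Stab_fcfm V E \<subseteq> Ncond V E"
  proof
    fix \<mu> assume \<mu>: "\<mu> \<in> Stab_fcfm V E"
    interpret matching_model V E \<mu> using \<mu> by (intro model supp) simp
    show "\<mu> \<in> Ncond V E"
      using \<mu> by (intro stable_imp_Ncond assms)
        (simp add: Stab_fcfm_def fcfm_positive_recurrent_def Nil_admissible)
  qed
  moreover have "Ncond V E \<subseteq> Stab_fcfm V E"
  proof
    fix \<mu> assume \<mu>: "\<mu> \<in> Ncond V E"
    interpret matching_model V E \<mu> using \<mu> by (intro model supp) simp
    obtain \<pi> where \<pi>: "fcfm_stationary V E \<mu> \<pi>" "\<And>w. pmf \<pi> w = invariant_weight w / partition_function"
      using ex_fcfm_stationary[OF \<mu>] by blast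
    have "expected_return_time V E \<mu> w < \<infinity>" if "w \<in> admissible_words V E" for w
      using that invariant_weight_pos partition_function_pos[OF \<mu>]
      by (intro expected_return_time_finite[OF \<pi>(1)]) (simp_all add: \<pi>(2) admissible_subset)
    then show "\<mu> \<in> Stab_fcfm V E"
      using supp \<mu> by (simp add: Stab_fcfm_def fcfm_positive_recurrent_def full_support_measures_def)
  qed
  moreover have "(\<exists>!\<pi>. fcfm_stationary V E \<mu> \<pi>) \<and>
       (\<forall>\<pi> e. fcfm_stationary V E \<mu> \<pi> \<and> enumerates_independents V E e \<longrightarrow>
          pmf \<pi> [] = fcfm_alpha V E \<mu> e \<and>
          (\<forall>w\<in>admissible_words V E - {[]}.
             pmf \<pi> w = fcfm_alpha V E \<mu> e *
               (\<Prod>l=1..length w.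
                  pmf \<mu> (w ! (l - 1)) / measure_pmf.prob \<mu> (nbhd V E (set (take l w))))))"
    if \<mu>: "\<mu> \<in> Ncond V E" for \<mu>
  proof -
    interpret matching_model V E \<mu> using \<mu> by (intro model supp) simp
    obtain \<pi> where \<pi>: "fcfm_stationary V E \<mu> \<pi>" "\<And>w. pmf \<pi> w = invariant_weight w / partition_function"
      using ex_fcfm_stationary[OF \<mu>] by blast
    have uniq: "\<rho> = \<pi>" if "fcfm_stationary V E \<mu> \<rho>" for \<rho>
      using fcfm_stationary_unique[OF that \<pi>(1)] .
    have formula: "pmf \<pi> w = fcfm_alpha V E \<mu> e *
        (\<Prod>l=1..length w. pmf \<mu> (w ! (l - 1)) / measure_pmf.prob \<mu> (nbhd V E (set (take l w))))"
      if "enumerates_independents V E e" "w \<in> admissible_words V E" for e w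
      using that(2) by (simp add: \<pi>(2) fcfm_alpha_eq[OF that(1)] invariant_weight_def path_weight_eq_prod)
    show ?thesis
    proof (intro conjI allI impI ballI)
      show "\<exists>!\<pi>. fcfm_stationary V E \<mu> \<pi>" using \<pi>(1) uniq by (rule ex1I)
    next
      fix \<rho> e assume a: "fcfm_stationary V E \<mu> \<rho> \<and> enumerates_independents V E e"
      then show "pmf \<rho> [] = fcfm_alpha V E \<mu> e"
        using uniq[of \<rho>] formula[of e "[]"] Nil_admissible by simp
      fix w assume "w \<in> admissible_words V E - {[]}"
      with a show "pmf \<rho> w = fcfm_alpha V E \<mu> e *
          (\<Prod>l=1..length w. pmf \<mu> (w ! (l - 1)) / measure_pmf.prob \<mu> (nbhd V E (set (take l w))))"
        using uniq[of \<rho>] formula[of e w] by simp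
    qed
  qed
  ultimately show ?thesis by blast
qed

end
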